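(* Let $d\geq 4$, $k\in\{2,3,\ldots,d-2\}$, $m:=\min\{d-k,k\}$, and $1\leq p,q\leq \infty$. Suppose that there is a constant $C(k,d,p,q)<\infty$ such that the inequality $$\|\widehat f\|_{L^q(\mathbb{S}^{d-1})}\leq C(k,d,p,q)\,\|f\|_{L^p(\mathbb{R}^d)}$$ holds within the class of $G_k$-symmetric functions $f:\mathbb{R}^d\to\mathbb{C}$. Then one of the following conditions is satisfied: (i) $\frac{d+1}{2d}<\frac1p<\frac{m+1}{2m}$ and $\frac{d+m}{p}+\frac{d-m}{q}\geq d+1$; (ii) $\frac1p=\frac{m+1}{2m}$ and $\frac1p+\frac1q> 1$; (iii) $\frac1p>\frac{m+1}{2m}$ and $\frac1p+\frac1q\geq 1$.
   Context: $\mathbb{S}^{d-1}\subset\mathbb{R}^d$ is the unit sphere with its usual (unnormalized) surface measure $\sigma$; $\|F\|_{L^q(\mathbb{S}^{d-1})}=(\int_{\mathbb{S}^{d-1}}|F|^q\,d\sigma)^{1/q}$ (essential supremum if $q=\infty$). The Fourier transform is $\widehat f(\xi)=\int_{\mathbb{R}^d} f(x)e^{-i\xi\cdot x}\,dx$. Write $\mathbb{R}^d=\mathbb{R}^{d-k}\times\mathbb{R}^k$ and let $G_k:=O(d-k)\times O(k)\subset O(d)$ act blockwise. A function $f:\mathbb{R}^d\to\mathbb{C}$ is $G_k$-symmetric if $f\circ A=f$ for every $A\in G_k$. As usual in restriction theory, such an inequality is understood a priori for $G_k$-symmetric Schwartz functions $f$. Convention: $\frac1\infty=0$. *)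

theory Defs
  imports "HOL-Probability.Essential_Supremum"
begin

text \<open>Surface measure on the unit sphere in its cone form
  \<open>\<sigma>(A) = d \<cdot> vol {r u | 0 < r < 1, u \<in> A}\<close>, i.e. the measure for which integration in polar
  coordinates holds; it is not normalized (see \<open>emeasure_sphere_measure\<close>).\<close>

definition sphere_measure :: "'a::euclidean_space measure" where
  "sphere_measure = scale_measure (of_nat DIM('a))
     (distr (restrict_space lborel (ball 0 1 - {0})) (restrict_space borel (sphere 0 1)) sgn)"

lemma measurable_sgn_sphere:
  "sgn \<in> measurable (restrict_space lborel (ball (0::'a::euclidean_space) 1 - {0}))
            (restrict_space borel (sphere 0 1))"
proof (rule measurable_restrict_space2)
  show "sgn \<in> space (restrict_space lborel (ball (0::'a) 1 - {0})) \<rightarrow> sphere 0 1"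
    by (auto simp: space_restrict_space norm_sgn)
  show "sgn \<in> borel_measurable (restrict_space lborel (ball (0::'a) 1 - {0}))"
    by (rule measurable_restrict_space1) simp
qed

lemma space_sphere_measure: "space sphere_measure = sphere (0::'a::euclidean_space) 1"
  by (simp add: sphere_measure_def space_scale_measure space_restrict_space)

lemma emeasure_sphere_measure:
  fixes A :: "'a::euclidean_space set"
  assumes A: "A \<in> sets borel" "A \<subseteq> sphere 0 1"
  shows "emeasure sphere_measure A =
           of_nat DIM('a) * emeasure lborel {r *\<^sub>R u |r u. 0 < r \<and> r < 1 \<and> u \<in> A}"
proof -
  let ?R = "restrict_space lborel (ball (0::'a) 1 - {0})"
  have "sgn -` A \<inter> space ?R = {r *\<^sub>R u |r u. 0 < r \<and> r < 1 \<and> u \<in> A}" (is "_ = ?C")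
  proof (intro equalityI subsetI)
    fix x assume "x \<in> sgn -` A \<inter> space ?R"
    then have "sgn x \<in> A" "0 < norm x" "norm x < 1"
      by (auto simp: space_restrict_space)
    moreover from this have "x = norm x *\<^sub>R sgn x" by (simp add: sgn_div_norm)
    ultimately show "x \<in> ?C" by blast
  next
    fix x assume "x \<in> ?C"
    then obtain r u where x: "x = r *\<^sub>R u" "0 < r" "r < 1" "u \<in> A" by blast
    with A have "norm u = 1" by auto
    then show "x \<in> sgn -` A \<inter> space ?R"
      using x by (auto simp: space_restrict_space sgn_div_norm)
  qed
  moreover have "A \<in> sets (restrict_space borel (sphere 0 1))"
    using A by (subst sets_restrict_space_iff) auto
  ultimately have "emeasure (distr ?R (restrict_space borel (sphere 0 1)) sgn) A = emeasure ?R ?C"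
    by (simp add: emeasure_distr[OF measurable_sgn_sphere])
  also have "\<dots> = emeasure lborel ?C"
    using A(2) by (intro emeasure_restrict_space) auto
  finally show ?thesis
    by (simp add: sphere_measure_def)
qed

text \<open>The \<open>L\<^sup>p\<close> norm for \<open>1 \<le> p \<le> \<infinity>\<close>, with value \<open>\<infinity>\<close> when \<open>f\<close> is not in \<open>L\<^sup>p\<close>.\<close>

definition Lp_norm :: "'a measure \<Rightarrow> ereal \<Rightarrow> ('a \<Rightarrow> complex) \<Rightarrow> ennreal" where
  "Lp_norm M p f =
     (if p = \<infinity> then esssup M (\<lambda>x. ennreal (cmod (f x)))
      else let I = \<integral>\<^sup>+x. ennreal (cmod (f x) powr real_of_ereal p) \<partial>M
           in if I = \<infinity> then \<infinity> else ennreal (enn2real I powr (1 / real_of_ereal p)))"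

definition fourier :: "('a::euclidean_space \<Rightarrow> complex) \<Rightarrow> 'a \<Rightarrow> complex" where
  "fourier f \<xi> = (\<integral>x. f x * exp (- \<i> * complex_of_real (\<xi> \<bullet> x)) \<partial>lborel)"

text \<open>\<open>partials [v\<^sub>1, \<dots>, v\<^sub>n] f\<close> is the iterated derivative of \<open>f\<close> in the directions
  \<open>v\<^sub>1, \<dots>, v\<^sub>n\<close>. It is meaningful only if the derivatives involved exist;
  \<open>schwartz\<close> requires that they do.\<close>

fun partials :: "'a::euclidean_space list \<Rightarrow> ('a \<Rightarrow> complex) \<Rightarrow> 'a \<Rightarrow> complex" where
  "partials [] f = f"
| "partials (v # vs) f = (\<lambda>x. frechet_derivative (partials vs f) (at x) v)"

definition schwartz :: "('a::euclidean_space \<Rightarrow> complex) \<Rightarrow> bool" where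
  "schwartz f \<longleftrightarrow>
     (\<forall>vs. set vs \<subseteq> Basis \<longrightarrow>
        (\<forall>x. partials vs f differentiable at x) \<and>
        (\<forall>N::nat. bounded (range (\<lambda>x. (1 + norm x) ^ N *\<^sub>R partials vs f x))))"

text \<open>The group \<open>O(d-k) \<times> O(k)\<close> acting blockwise, with the two blocks \<open>\<real>\<^sup>d\<^sup>-\<^sup>k\<close> and \<open>\<real>\<^sup>k\<close> being
  the types \<open>'a\<close> and \<open>'b\<close>. The product type carries the Euclidean norm and Lebesgue measure.\<close>

definition block_orthogonal ::
    "('a::euclidean_space \<times> 'b::euclidean_space \<Rightarrow> 'a \<times> 'b) set" where
  "block_orthogonal =
     {map_prod A B |A B. orthogonal_transformation A \<and> orthogonal_transformation B}"

definition block_symmetric ::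
    "('a::euclidean_space \<times> 'b::euclidean_space \<Rightarrow> complex) \<Rightarrow> bool" where
  "block_symmetric f \<longleftrightarrow> (\<forall>A\<in>block_orthogonal. f \<circ> A = f)"

end

theory Submission
  imports Defs "HOL-Probability.Probability"
begin

text \<open>The theorem follows by inserting explicit functions into the inequality. Write \<open>a = 1/p\<close> and
  \<open>b = 1/q\<close>. The building block on \<open>\<real>\<^sup>n\<close> is the packet
  \<open>f\<^sub>R(x) = exp (- |x|\<^sup>2 / (2 R\<^sup>2)) \<cdot> \<integral>\<^bsub>S\<^esub> exp (- i x \<bullet> \<omega>) d\<omega>\<close>, where \<open>S\<close> is the shell
  \<open>{\<omega>. \<bar>|\<omega>| - 1\<bar> \<le> 1/R}\<close>. It is a radial Schwartz function, and its Fourier transform is a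
  Gaussian of width \<open>1/R\<close> averaged over a shell of the same width. Hence the transform is nonnegative,
  bounded above by a constant, and bounded below by a positive constant for \<open>\<bar>|\<xi>| - 1\<bar> \<le> 1/R\<close>
  (\<open>packet_hat_le\<close>, \<open>packet_hat_ge\<close>).

  No asymptotics of Bessel functions enter: the size of \<open>f\<^sub>R\<close> is controlled by its energy. By the
  multiplication formula, the integral of \<open>|f\<^sub>R|\<^sup>2\<close> divided by the Gaussian equals the integral of
  the transform of \<open>f\<^sub>R\<close> over the shell, which is \<open>O(1/R)\<close> (\<open>packet_energy\<close>). As \<open>f\<^sub>R\<close> lives on the
  ball of radius \<open>R\<close>, interpolating between this bound and the volume of the ball gives
  \<open>\<parallel>f\<^sub>R\<parallel>\<^sub>p = O(R\<^bsup>na - (n+1)/2\<^esup>)\<close> for \<open>p \<le> 2\<close> (\<open>packet_Lp_low\<close>), and \<open>\<parallel>f\<^sub>R\<parallel>\<^sub>p\<close> tends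
  to \<open>0\<close> for \<open>p \<ge> 2\<close>.
  At the critical exponent \<open>a = (n+1)/(2n)\<close> the packets \<open>f\<^bsub>2^j\<^esub>\<close> with \<open>1 \<le> j \<le> J\<close> all have norm
  \<open>O(1)\<close> but live at different scales, so that their sum has norm \<open>O(J\<^sup>a)\<close>, while its
  transform is at least a multiple of \<open>J\<close> near the sphere (\<open>burst_Lp_critical\<close>, \<open>fourier_burst_ge\<close>).

  With \<open>n = d\<close>, these functions rule out \<open>a \<le> (d+1)/(2d)\<close>. For the other conditions put the packet
  in the block of dimension \<open>m\<close> and multiply it by a Gaussian of width \<open>1/\<delta>\<close> in the
  other block. The transform of the product is concentrated on the part of the sphere within \<open>\<delta>\<close> of the
  unit sphere of the packet's block. That part has measure at least a multiple of \<open>\<delta>\<^bsup>d-m\<^esup>\<close>, and on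
  it the component in that block has norm within \<open>\<delta>\<^sup>2\<close> of \<open>1\<close>. A fixed packet and \<open>\<delta> \<rightarrow> 0\<close> give
  \<open>a + b \<ge> 1\<close>, the packet with \<open>R = \<delta>\<^bsup>-2\<^esup>\<close> gives \<open>(d+m) a + (d-m) b \<ge> d+1\<close>, and the
  sum of packets with \<open>2\<^sup>J = \<delta>\<^bsup>-2\<^esup>\<close> excludes \<open>a + b = 1\<close> at \<open>a = (m+1)/(2m)\<close>. All these
  computations have the same form, which \<open>radial_bound\<close> isolates.\<close>

section \<open>Gaussians and their Fourier transform\<close>

lemma has_bochner_integral_lborel_prod:
  fixes f :: "'a::euclidean_space \<Rightarrow> real \<Rightarrow> complex"
  assumes int: "\<And>b. b \<in> Basis \<Longrightarrow> integrable lborel (f b)"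
  shows "has_bochner_integral lborel (\<lambda>x::'a. \<Prod>b\<in>Basis. f b (x \<bullet> b))
           (\<Prod>b\<in>Basis. \<integral>x. f b x \<partial>lborel)"
proof -
  interpret product_sigma_finite "\<lambda>_::'a. lborel :: real measure" by standard
  have [measurable]: "f b \<in> borel_measurable borel" if "b \<in> Basis" for b
    using int[OF that] by (auto dest: borel_measurable_integrable)
  let ?T = "\<lambda>g::'a \<Rightarrow> real. \<Sum>b\<in>Basis. g b *\<^sub>R b"
  have m: "(\<lambda>x::'a. \<Prod>b\<in>Basis. f b (x \<bullet> b)) \<in> borel_measurable borel" by measurable
  have T: "?T \<in> measurable (\<Pi>\<^sub>M b\<in>Basis. lborel) borel" by measurable
  have 1: "integrable (\<Pi>\<^sub>M b\<in>Basis. lborel) (\<lambda>g. \<Prod>b\<in>Basis. f b (?T g \<bullet> b))"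
    using product_integrable_prod[OF finite_Basis, of f] int by (simp cong: prod.cong)
  have 2: "(\<integral>g. (\<Prod>b\<in>Basis. f b (?T g \<bullet> b)) \<partial>(\<Pi>\<^sub>M b\<in>Basis. lborel)) =
     (\<Prod>b\<in>Basis. \<integral>x. f b x \<partial>lborel)"
    using product_integral_prod[OF finite_Basis, of f] int by (simp cong: prod.cong)
  show ?thesis
    by (subst lborel_eq)
      (use 1 2 in \<open>simp add: has_bochner_integral_iff integrable_distr_eq[OF T m] integral_distr[OF T m]\<close>)
qed

text \<open>The characteristic function of the standard normal distribution, rescaled.\<close>

lemma fourier_gaussian_real:
  fixes R t :: real assumes R: "R > 0"
  shows "has_bochner_integral lborel (\<lambda>x. complex_of_real (exp (- x\<^sup>2 / (2 * R\<^sup>2))) * exp (- \<i> * complex_of_real (t * x)))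
     (complex_of_real (sqrt (2 * pi) * R * exp (- (R\<^sup>2 * t\<^sup>2) / 2)))"
proof -
  \<comment> \<open>The frequency \<open>- R t\<close> turns into \<open>- t\<close> under the substitution of \<open>x / R\<close> for \<open>x\<close>.\<close>
  let ?h = "\<lambda>x. std_normal_density x *\<^sub>R iexp ((- R * t) * x)"
  have i: "integrable lborel ?h"
    by (rule Bochner_Integration.integrable_bound[OF integrable_std_normal_moment[of 0]])
       (auto simp: norm_mult)
  have "char std_normal_distribution (- R * t) = (\<integral>x. ?h x \<partial>lborel)"
    unfolding char_def by (subst integral_density) (auto simp: normal_density_nonneg)
  then have v: "(\<integral>x. ?h x \<partial>lborel) = complex_of_real (exp (- (R\<^sup>2 * t\<^sup>2) / 2))"
    by (simp add: char_std_normal_distribution power_mult_distrib)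
  have "has_bochner_integral lborel ?h (complex_of_real (exp (- (R\<^sup>2 * t\<^sup>2) / 2)))"
    using i v by (simp add: has_bochner_integral_iff)
  then have "has_bochner_integral lborel (\<lambda>x. ?h (0 + (1/R) * x))
      (complex_of_real (exp (- (R\<^sup>2 * t\<^sup>2) / 2)) /\<^sub>R \<bar>1/R\<bar>)"
    using R by (subst (asm) lborel_has_bochner_integral_real_affine_iff[of "1/R" _ _ 0]) simp_all
  then have "has_bochner_integral lborel (\<lambda>x. complex_of_real (sqrt (2 * pi)) * ?h (0 + (1/R) * x))
      (complex_of_real (sqrt (2 * pi)) * (complex_of_real (exp (- (R\<^sup>2 * t\<^sup>2) / 2)) /\<^sub>R \<bar>1/R\<bar>))"
    by (rule has_bochner_integral_mult_right)
  moreover have "complex_of_real (sqrt (2 * pi)) * ?h (0 + (1/R) * x) =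
      complex_of_real (exp (- x\<^sup>2 / (2 * R\<^sup>2))) * exp (- \<i> * complex_of_real (t * x))" for x
    using R by (simp add: std_normal_density_def scaleR_conv_of_real power_divide field_simps flip: of_real_mult)
  moreover have "complex_of_real (sqrt (2 * pi)) * (complex_of_real (exp (- (R\<^sup>2 * t\<^sup>2) / 2)) /\<^sub>R \<bar>1/R\<bar>)
    = complex_of_real (sqrt (2 * pi) * R * exp (- (R\<^sup>2 * t\<^sup>2) / 2))"
    using R by (simp add: scaleR_conv_of_real)
  ultimately show ?thesis by simp
qed

definition gauss :: "real \<Rightarrow> 'a::euclidean_space \<Rightarrow> real" where
  "gauss R x = exp (- (norm x)\<^sup>2 / (2 * R\<^sup>2))"

lemma gauss_pos [simp]: "gauss R x > 0" and gauss_nonneg [simp]: "gauss R x \<ge> 0"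
  by (auto simp: gauss_def)

lemma gauss_le_1: "gauss R x \<le> 1"
  by (simp add: gauss_def)

lemma gauss_measurable [measurable]: "gauss R \<in> borel_measurable borel"
  unfolding gauss_def[abs_def] by measurable

lemma gauss_eq_prod: "gauss R x = (\<Prod>b\<in>Basis. exp (- (x \<bullet> b)\<^sup>2 / (2 * R\<^sup>2)))"
proof -
  have "(norm x)\<^sup>2 = (\<Sum>b\<in>Basis. (x \<bullet> b)\<^sup>2)"
    unfolding power2_norm_eq_inner by (subst euclidean_inner) (simp only: power2_eq_square)
  then show ?thesis
    by (simp add: gauss_def exp_sum[symmetric] sum_negf sum_divide_distrib)
qed

lemma has_bochner_integral_gauss_character:
  fixes \<xi> :: "'a::euclidean_space" assumes R: "R > 0"
  shows "has_bochner_integral lborel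
           (\<lambda>x. complex_of_real (gauss R x) * exp (- \<i> * complex_of_real (\<xi> \<bullet> x)))
           (complex_of_real ((sqrt (2 * pi) * R) ^ DIM('a) * gauss (1 / R) \<xi>))"
proof -
  have e: "complex_of_real (gauss R x) * exp (- \<i> * complex_of_real (\<xi> \<bullet> x)) =
     (\<Prod>b\<in>Basis. complex_of_real (exp (- (x \<bullet> b)\<^sup>2 / (2 * R\<^sup>2))) * exp (- \<i> * complex_of_real ((\<xi> \<bullet> b) * (x \<bullet> b))))" for x
  proof -
    have "exp (- \<i> * complex_of_real (\<xi> \<bullet> x)) = (\<Prod>b\<in>Basis. exp (- \<i> * complex_of_real ((\<xi> \<bullet> b) * (x \<bullet> b))))"
      by (simp add: euclidean_inner[of \<xi> x] sum_distrib_left sum_negf flip: exp_sum)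
    then show ?thesis by (simp only: gauss_eq_prod of_real_prod prod.distrib)
  qed
  have "(\<Prod>b\<in>(Basis::'a set). complex_of_real (sqrt (2 * pi) * R * exp (- (R\<^sup>2 * (\<xi> \<bullet> b)\<^sup>2) / 2)))
      = complex_of_real ((sqrt (2 * pi) * R) ^ DIM('a) * gauss (1 / R) \<xi>)"
    using R by (simp add: gauss_eq_prod prod.distrib prod_power_distrib power_divide field_simps)
  moreover have "has_bochner_integral lborel
           (\<lambda>x. complex_of_real (gauss R x) * exp (- \<i> * complex_of_real (\<xi> \<bullet> x)))
           (\<Prod>b\<in>(Basis::'a set). complex_of_real (sqrt (2 * pi) * R * exp (- (R\<^sup>2 * (\<xi> \<bullet> b)\<^sup>2) / 2)))"
    unfolding e
    using has_bochner_integral_lborel_prod[of "\<lambda>b x. complex_of_real (exp (- x\<^sup>2 / (2 * R\<^sup>2))) * exp (- \<i> * complex_of_real ((\<xi> \<bullet> b) * x))"]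
      fourier_gaussian_real[OF R] by (simp add: has_bochner_integral_iff)
  ultimately show ?thesis by simp
qed

lemma fourier_gauss:
  fixes \<xi> :: "'a::euclidean_space" assumes "R > 0"
  shows "fourier (\<lambda>x. complex_of_real (gauss R x)) \<xi> =
    complex_of_real ((sqrt (2 * pi) * R) ^ DIM('a) * gauss (1 / R) \<xi>)"
  using has_bochner_integral_gauss_character[OF assms, of \<xi>]
  by (simp add: fourier_def has_bochner_integral_iff)

lemma has_bochner_integral_gauss:
  assumes R: "R > 0"
  shows "has_bochner_integral lborel (gauss R :: 'a::euclidean_space \<Rightarrow> real) ((sqrt (2 * pi) * R) ^ DIM('a))"
proof -
  have "has_bochner_integral lborel (\<lambda>x::'a. complex_of_real (gauss R x)) (complex_of_real ((sqrt (2 * pi) * R) ^ DIM('a)))"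
    using has_bochner_integral_gauss_character[OF R, of "0::'a"] by (simp add: gauss_def[of _ 0])
  then show ?thesis
    unfolding has_bochner_integral_iff by (metis complex_of_real_integrable_eq integral_complex_of_real of_real_eq_iff)
qed

section \<open>Orthogonal invariance of Lebesgue measure\<close>

lemma nn_integral_lborel_shift:
  fixes f :: "'a::euclidean_space \<Rightarrow> ennreal"
  assumes [measurable]: "f \<in> borel_measurable borel"
  shows "(\<integral>\<^sup>+x. f (c + x) \<partial>lborel) = (\<integral>\<^sup>+x. f x \<partial>lborel)"
proof -
  have "(\<integral>\<^sup>+x. f x \<partial>lborel) = (\<integral>\<^sup>+x. f x \<partial>distr lborel borel ((+) c))"
    by (simp add: lborel_distr_plus)
  also have "\<dots> = (\<integral>\<^sup>+x. f (c + x) \<partial>lborel)"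
    by (subst nn_integral_distr) auto
  finally show ?thesis by simp
qed

text \<open>The image measure is translation invariant because \<open>A\<close> is linear and onto, and it agrees with Lebesgue
  measure on the unit ball \<open>N\<close> because \<open>A\<close> is isometric. These two properties determine it: for a
  Borel set \<open>B\<close>, both sides of the claim, multiplied by the measure of \<open>N\<close>, are values of the
  integral of the indicator of \<open>{(x, y). y \<in> N \<and> y + A x \<in> B}\<close> in the two orders of integration.\<close>

lemma distr_lborel_orthogonal:
  fixes A :: "'a::euclidean_space \<Rightarrow> 'a"
  assumes A: "orthogonal_transformation A"
  shows "distr lborel borel A = lborel"
proof (rule measure_eqI)
  have lin: "linear A" using A by (rule orthogonal_transformation_linear)
  then have cA: "continuous_on UNIV A"
    using linear_continuous_on linear_linear by blast
  then have mA [measurable]: "A \<in> borel_measurable borel"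
    by (rule borel_measurable_continuous_onI)
  fix B assume "B \<in> sets (distr lborel borel A)"
  then have [measurable]: "B \<in> sets borel" by simp
  let ?N = "ball (0::'a) 1"
  have surj: "\<exists>z. A z = y" for y
    using orthogonal_transformation_surj[OF A] by (metis surjD)
  have shift: "(\<integral>\<^sup>+x. indicator B (y + A x) \<partial>lborel) = emeasure (distr lborel borel A) B" for y
  proof -
    obtain z where z: "A z = y" using surj by blast
    have "(\<integral>\<^sup>+x. indicator B (y + A x) \<partial>lborel) = (\<integral>\<^sup>+x. indicator B (A (z + x)) \<partial>lborel)"
      using lin z by (simp add: linear_add)
    also have "\<dots> = (\<integral>\<^sup>+x. indicator B (A x) \<partial>lborel)"
      by (rule nn_integral_lborel_shift) measurable
    also have "\<dots> = (\<integral>\<^sup>+x. indicator B x \<partial>distr lborel borel A)"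
      by (subst nn_integral_distr) auto
    finally show ?thesis by simp
  qed
  have ball: "(\<integral>\<^sup>+x. indicator ?N (y - A x) \<partial>lborel) = emeasure lborel ?N" for y
  proof -
    obtain z where z: "A z = y" using surj by blast
    have "y - A x \<in> ?N \<longleftrightarrow> x \<in> ball z 1" for x
      using lin z orthogonal_transformation_norm[OF A, of "z - x"]
      by (simp add: linear_diff dist_norm norm_minus_commute)
    then have "(\<integral>\<^sup>+x. indicator ?N (y - A x) \<partial>lborel) = (\<integral>\<^sup>+x. indicator (ball z 1) x \<partial>lborel)"
      by (intro nn_integral_cong) (auto simp: indicator_def)
    then show ?thesis by (simp add: emeasure_ball)
  qed
  define iN iB :: "'a \<Rightarrow> ennreal" where "iN = indicator ?N" and "iB = indicator B"
  have [measurable]: "iN \<in> borel_measurable borel" "iB \<in> borel_measurable borel"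
    unfolding iN_def iB_def by (rule borel_measurable_indicator, simp)+
  have "emeasure (distr lborel borel A) B * emeasure lborel ?N =
      (\<integral>\<^sup>+y. iN y * (\<integral>\<^sup>+x. iB (y + A x) \<partial>lborel) \<partial>lborel)"
    by (subst shift[folded iB_def]) (subst nn_integral_multc, simp_all add: mult.commute, simp add: iN_def mult.commute)
  also have "\<dots> = (\<integral>\<^sup>+y. (\<integral>\<^sup>+x. iN y * iB (y + A x) \<partial>lborel) \<partial>lborel)"
    by (subst nn_integral_cmult) auto
  also have "\<dots> = (\<integral>\<^sup>+x. (\<integral>\<^sup>+y. iN y * iB (y + A x) \<partial>lborel) \<partial>lborel)"
    by (rule lborel_pair.Fubini') measurable
  also have "\<dots> = (\<integral>\<^sup>+x. (\<integral>\<^sup>+y. iN (y - A x) * iB y \<partial>lborel) \<partial>lborel)"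
  proof (rule nn_integral_cong)
    fix x
    show "(\<integral>\<^sup>+y. iN y * iB (y + A x) \<partial>lborel) = (\<integral>\<^sup>+y. iN (y - A x) * iB y \<partial>lborel)"
      using nn_integral_lborel_shift[of "\<lambda>y. iN (y - A x) * iB y" "A x"]
      by (simp add: add.commute)
  qed
  also have "\<dots> = (\<integral>\<^sup>+y. (\<integral>\<^sup>+x. iN (y - A x) * iB y \<partial>lborel) \<partial>lborel)"
    by (rule lborel_pair.Fubini') measurable
  also have "\<dots> = emeasure lborel ?N * emeasure lborel B"
    by (simp add: nn_integral_multc ball[folded iN_def] nn_integral_cmult) (simp add: iB_def)
  finally show "emeasure (distr lborel borel A) B = emeasure lborel B"
    using unit_ball_vol_pos[of "real DIM('a)", THEN less_imp_neq] by (simp add: emeasure_ball mult.commute[of _ "ennreal _"] ennreal_mult_cancel_left)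
qed simp

section \<open>Schwartz functions\<close>

text \<open>To see that \<open>f\<close> is a Schwartz function, it suffices to place it in a class \<open>K\<close> of rapidly decaying
  differentiable functions that is closed under partial derivatives. The iterated derivatives then never
  have to be computed.\<close>

lemma schwartz_coinduct:
  assumes "f \<in> K"
    and der: "\<And>f. f \<in> K \<Longrightarrow> \<exists>f'. (\<forall>x. (f has_derivative f' x) (at x)) \<and> (\<forall>v\<in>Basis. (\<lambda>x. f' x v) \<in> K)"
    and dec: "\<And>f N. f \<in> K \<Longrightarrow> bounded (range (\<lambda>x. (1 + norm x) ^ N *\<^sub>R f x))"
  shows "schwartz f"
proof -
  have "partials vs f \<in> K" if "set vs \<subseteq> Basis" for vs
    using that
  proof (induction vs)
    case (Cons v vs)
    then obtain f' where f': "\<And>x. (partials vs f has_derivative f' x) (at x)" "(\<lambda>x. f' x v) \<in> K"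
      using der[of "partials vs f"] by auto
    have "frechet_derivative (partials vs f) (at x) = f' x" for x
      using frechet_derivative_at[OF f'(1)] by simp
    with f'(2) show ?case by simp
  qed (use assms(1) in simp)
  with der dec show ?thesis
    unfolding schwartz_def differentiable_def by meson
qed

lemma schwartz_has_derivative:
  assumes "schwartz f"
  shows "(f has_derivative frechet_derivative f (at x)) (at x)"
  using assms[unfolded schwartz_def, rule_format, of "[]"] by (simp add: frechet_derivative_works)

lemma schwartz_bounded:
  assumes "schwartz f"
  shows "bounded (range (\<lambda>x. (1 + norm x) ^ N *\<^sub>R f x))"
  using assms[unfolded schwartz_def, rule_format, of "[]"] by simp

lemma schwartz_partial:
  assumes "schwartz f" "v \<in> Basis"
  shows "schwartz (\<lambda>x. frechet_derivative f (at x) v)"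
proof -
  have "partials vs (\<lambda>x. frechet_derivative f (at x) v) = partials (vs @ [v]) f" for vs
    by (induction vs) simp_all
  then show ?thesis
    using assms unfolding schwartz_def by simp
qed

lemma schwartz_add:
  assumes "schwartz f" "schwartz g"
  shows "schwartz (\<lambda>x. f x + g x)"
proof (rule schwartz_coinduct[where K = "{\<lambda>x. f x + g x |f g. schwartz f \<and> schwartz g}"])
  fix h :: "'a \<Rightarrow> complex" and N :: nat
  assume "h \<in> {\<lambda>x. f x + g x |f g. schwartz f \<and> schwartz g}"
  then obtain f g where h: "h = (\<lambda>x. f x + g x)" and fg: "schwartz f" "schwartz g" by auto
  show "\<exists>f'. (\<forall>x. (h has_derivative f' x) (at x)) \<and>
        (\<forall>v\<in>Basis. (\<lambda>x. f' x v) \<in> {\<lambda>x. f x + g x |f g. schwartz f \<and> schwartz g})"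
    unfolding h using fg
    by (intro exI[of _ "\<lambda>x v. frechet_derivative f (at x) v + frechet_derivative g (at x) v"])
      (auto intro!: has_derivative_add schwartz_has_derivative schwartz_partial)
  show "bounded (range (\<lambda>x. (1 + norm x) ^ N *\<^sub>R h x))"
    using bounded_plus_comp[OF schwartz_bounded[OF fg(1), of N] schwartz_bounded[OF fg(2), of N]]
    by (simp add: h scaleR_add_right)
qed (use assms in auto)

lemma schwartz_zero: "schwartz (\<lambda>_. 0)"
proof (rule schwartz_coinduct[where K = "{\<lambda>_. 0}"])
  fix f :: "'a \<Rightarrow> complex" assume "f \<in> {\<lambda>_. 0}"
  then show "\<exists>f'. (\<forall>x. (f has_derivative f' x) (at x)) \<and> (\<forall>v\<in>Basis. (\<lambda>x. f' x v) \<in> {\<lambda>_. 0})"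
    by (intro exI[of _ "\<lambda>_ _. 0"]) auto
qed auto

lemma schwartz_sum:
  assumes "\<And>i. i \<in> I \<Longrightarrow> schwartz (f i)"
  shows "schwartz (\<lambda>x. \<Sum>i\<in>I. f i x)"
  using assms by (induction I rule: infinite_finite_induct) (auto intro: schwartz_zero schwartz_add)

text \<open>The products of Schwartz functions of the two variables form a class to which \<open>schwartz_coinduct\<close>
  applies: a basis vector of the product space lies in one of the two factors, so a partial derivative acts
  on one factor only and the product rule leaves a single product.\<close>

lemma schwartz_tensor:
  fixes f :: "'a::euclidean_space \<Rightarrow> complex" and g :: "'b::euclidean_space \<Rightarrow> complex"
  assumes "schwartz f" "schwartz g"
  shows "schwartz (\<lambda>z. f (fst z) * g (snd z))"
proof -
  define K where "K = {\<lambda>z. f (fst z) * g (snd z) |(f :: 'a \<Rightarrow> complex) (g :: 'b \<Rightarrow> complex). schwartz f \<and> schwartz g}"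
  show ?thesis
  proof (rule schwartz_coinduct[where K = K])
    fix h :: "'a \<times> 'b \<Rightarrow> complex" and N :: nat
    assume "h \<in> K"
    then obtain f g where h: "h = (\<lambda>z. f (fst z) * g (snd z))" and fg: "schwartz f" "schwartz g"
      by (auto simp: K_def)
    let ?h' = "\<lambda>z v. f (fst z) * frechet_derivative g (at (snd z)) (snd v)
                  + frechet_derivative f (at (fst z)) (fst v) * g (snd z)"
    have d: "(h has_derivative ?h' z) (at z)" for z
      unfolding h
      by (intro has_derivative_mult has_derivative_compose[OF has_derivative_fst[OF has_derivative_ident] schwartz_has_derivative[OF fg(1)]]
           has_derivative_compose[OF has_derivative_snd[OF has_derivative_ident] schwartz_has_derivative[OF fg(2)]])
    have lin: "linear (frechet_derivative f (at x))" "linear (frechet_derivative g (at y))" for x y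
      using schwartz_has_derivative[OF fg(1)] schwartz_has_derivative[OF fg(2)]
      by (auto dest: has_derivative_bounded_linear intro: bounded_linear.linear)
    have "(\<lambda>z. ?h' z v) \<in> K" if v: "v \<in> Basis" for v
    proof -
      from v consider u where "u \<in> Basis" "v = (u, 0)" | u where "u \<in> Basis" "v = (0, u)"
        by (auto simp: Basis_prod_def)
      then show ?thesis
      proof cases
        case (1 u)
        then have "(\<lambda>z. ?h' z v) = (\<lambda>z. frechet_derivative f (at (fst z)) u * g (snd z))"
          using linear_0[OF lin(2)] by auto
        then show ?thesis
          unfolding K_def mem_Collect_eq
          by (intro exI[of _ "\<lambda>x. frechet_derivative f (at x) u"] exI[of _ g])
             (use schwartz_partial[OF fg(1) 1(1)] fg in auto)
      next
        case (2 u)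
        then have "(\<lambda>z. ?h' z v) = (\<lambda>z. f (fst z) * frechet_derivative g (at (snd z)) u)"
          using linear_0[OF lin(1)] by auto
        then show ?thesis
          unfolding K_def mem_Collect_eq
          by (intro exI[of _ f] exI[of _ "\<lambda>x. frechet_derivative g (at x) u"])
             (use schwartz_partial[OF fg(2) 2(1)] fg in auto)
      qed
    qed
    with d show "\<exists>f'. (\<forall>x. (h has_derivative f' x) (at x)) \<and> (\<forall>v\<in>Basis. (\<lambda>x. f' x v) \<in> K)"
      by (intro exI[of _ ?h']) auto
    obtain A B where A: "\<And>x. norm ((1 + norm x) ^ N *\<^sub>R f x) \<le> A" and B: "\<And>x. norm ((1 + norm x) ^ N *\<^sub>R g x) \<le> B"
      using schwartz_bounded[OF fg(1), of N] schwartz_bounded[OF fg(2), of N]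
      unfolding bounded_iff by blast
    have "norm ((1 + norm z) ^ N *\<^sub>R h z) \<le> A * B" for z :: "'a \<times> 'b"
    proof -
      have "norm z \<le> norm (fst z) + norm (snd z)"
        by (metis norm_Pair_le prod.collapse)
      then have "1 + norm z \<le> (1 + norm (fst z)) * (1 + norm (snd z))"
        by (simp add: algebra_simps) (smt (verit) mult_nonneg_nonneg norm_ge_zero)
      then have "(1 + norm z) ^ N \<le> ((1 + norm (fst z)) * (1 + norm (snd z))) ^ N"
        by (intro power_mono) auto
      then have "(1 + norm z) ^ N * norm (h z) \<le> ((1 + norm (fst z)) * (1 + norm (snd z))) ^ N * norm (h z)"
        by (rule mult_right_mono) simp
      also have "\<dots> = norm ((1 + norm (fst z)) ^ N *\<^sub>R f (fst z)) * norm ((1 + norm (snd z)) ^ N *\<^sub>R g (snd z))"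
        by (simp add: h norm_mult power_mult_distrib)
      also have "\<dots> \<le> A * B"
        by (intro mult_mono A B) (auto intro: order_trans[OF norm_ge_zero A])
      finally show ?thesis by simp
    qed
    then show "bounded (range (\<lambda>z. (1 + norm z) ^ N *\<^sub>R h z))"
      unfolding bounded_iff by blast
  qed (use assms in \<open>auto simp: K_def\<close>)
qed

text \<open>Contains the Gaussian times every member of \<open>U\<close>, and partial derivatives do not leave the class when
  \<open>U\<close> is closed under them: differentiating the Gaussian produces the coordinate factors.\<close>

inductive_set gauss_span :: "real \<Rightarrow> ('a::euclidean_space \<Rightarrow> complex) set \<Rightarrow> ('a \<Rightarrow> complex) set"
  for R U where
  base: "u \<in> U \<Longrightarrow> (\<lambda>x. complex_of_real (gauss R x) * u x) \<in> gauss_span R U"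
| coord: "f \<in> gauss_span R U \<Longrightarrow> (\<lambda>x. complex_of_real (x \<bullet> v) * f x) \<in> gauss_span R U"
| scale: "f \<in> gauss_span R U \<Longrightarrow> (\<lambda>x. c * f x) \<in> gauss_span R U"
| add: "f \<in> gauss_span R U \<Longrightarrow> g \<in> gauss_span R U \<Longrightarrow> (\<lambda>x. f x + g x) \<in> gauss_span R U"

lemma gauss_has_derivative:
  "(gauss R has_derivative (\<lambda>v. - (x \<bullet> v) / R\<^sup>2 * gauss R x)) (at x)"
proof -
  define c where "c = - 1 / (2 * R\<^sup>2)"
  have e: "gauss R = (\<lambda>x::'a. exp (c * (x \<bullet> x)))"
    by (simp add: gauss_def[abs_def] power2_norm_eq_inner c_def)
  have "((\<lambda>x::'a. exp (c * (x \<bullet> x))) has_derivative (\<lambda>v. exp (c * (x \<bullet> x)) * (c * (x \<bullet> v + v \<bullet> x)))) (at x)"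
    by (auto intro!: derivative_eq_intros)
  then show ?thesis
    unfolding e by (rule has_derivative_eq_rhs) (simp add: c_def inner_commute fun_eq_iff)
qed

text \<open>The exponential series dominates \<open>(1 + t)\<^sup>N\<close> by \<open>N! exp (1 + t)\<close>, and completing the square bounds the
  remaining exponent.\<close>

lemma power_gauss_bounded:
  assumes "R > 0"
  shows "(1 + norm x) ^ N * gauss R x \<le> fact N * exp (1 + R\<^sup>2 / 2)"
proof -
  let ?t = "norm x"
  have "(1 + ?t) ^ N / fact N \<le> exp (1 + ?t)"
    using sum_le_suminf[OF summable_exp_generic, of "{N}" "1 + ?t"] by (simp add: exp_def divide_inverse mult.commute)
  moreover have "(1 + ?t) + (- ?t\<^sup>2 / (2 * R\<^sup>2)) \<le> 1 + R\<^sup>2 / 2"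
  proof -
    \<comment> \<open>The sum of \<open>?t\<close> and the exponent of the Gaussian is largest at \<open>?t = R\<^sup>2\<close>.\<close>
    have "0 \<le> (?t / R - R)\<^sup>2" by simp
    then show ?thesis using assms by (simp add: power2_diff power_divide field_simps power2_eq_square)
  qed
  ultimately have "(1 + ?t) ^ N * gauss R x \<le> fact N * (exp (1 + ?t) * gauss R x)"
    by (simp add: field_simps)
  also have "exp (1 + ?t) * gauss R x = exp ((1 + ?t) + (- ?t\<^sup>2 / (2 * R\<^sup>2)))"
    by (simp only: gauss_def exp_add)
  also have "fact N * \<dots> \<le> fact N * exp (1 + R\<^sup>2 / 2)"
    using \<open>(1 + ?t) + (- ?t\<^sup>2 / (2 * R\<^sup>2)) \<le> 1 + R\<^sup>2 / 2\<close> by simp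
  finally show ?thesis .
qed

lemma schwartz_gauss_times:
  fixes U :: "('a::euclidean_space \<Rightarrow> complex) set"
  assumes R: "R > 0" and u: "u \<in> U"
    and der: "\<And>u. u \<in> U \<Longrightarrow> \<exists>u'. (\<forall>x. (u has_derivative u' x) (at x)) \<and> (\<forall>v\<in>Basis. (\<lambda>x. u' x v) \<in> U)"
    and bnd: "\<And>u. u \<in> U \<Longrightarrow> bounded (range u)"
  shows "schwartz (\<lambda>x. complex_of_real (gauss R x) * u x)"
proof (rule schwartz_coinduct[where K = "gauss_span R U"])
  show "(\<lambda>x. complex_of_real (gauss R x) * u x) \<in> gauss_span R U"
    using u by (rule gauss_span.base)
  fix f :: "'a \<Rightarrow> complex"
  assume f: "f \<in> gauss_span R U"
  then show "\<exists>f'. (\<forall>x. (f has_derivative f' x) (at x)) \<and> (\<forall>v\<in>Basis. (\<lambda>x. f' x v) \<in> gauss_span R U)"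
  proof induction
    case (base u)
    obtain u' where u': "\<And>x. (u has_derivative u' x) (at x)" "\<And>v. v \<in> Basis \<Longrightarrow> (\<lambda>x. u' x v) \<in> U"
      using der[OF base] by blast
    show ?case
    proof (intro exI conjI allI ballI)
      fix x
      show "((\<lambda>x. complex_of_real (gauss R x) * u x) has_derivative
         (\<lambda>v. complex_of_real (gauss R x) * u' x v + (- 1 / complex_of_real (R\<^sup>2)) * (complex_of_real (x \<bullet> v) * (complex_of_real (gauss R x) * u x)))) (at x)"
        using has_derivative_mult[OF has_derivative_of_real[OF gauss_has_derivative[of R x]] u'(1)[of x]]
        by (simp add: algebra_simps)
      show "(\<lambda>x. complex_of_real (gauss R x) * u' x v + (- 1 / complex_of_real (R\<^sup>2)) * (complex_of_real (x \<bullet> v) * (complex_of_real (gauss R x) * u x)))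
           \<in> gauss_span R U" if "v \<in> Basis" for v
        using that by (intro gauss_span.intros u'(2) base)
    qed
  next
    case (coord f v)
    then obtain f' where f': "\<And>x. (f has_derivative f' x) (at x)" "\<And>v. v \<in> Basis \<Longrightarrow> (\<lambda>x. f' x v) \<in> gauss_span R U"
      by blast
    show ?case
    proof (intro exI conjI allI ballI)
      fix x
      show "((\<lambda>x. complex_of_real (x \<bullet> v) * f x) has_derivative
         (\<lambda>w. complex_of_real (x \<bullet> v) * f' x w + complex_of_real (w \<bullet> v) * f x)) (at x)"
        by (intro has_derivative_mult has_derivative_of_real has_derivative_inner_left has_derivative_ident f')
      show "(\<lambda>x. complex_of_real (x \<bullet> v) * f' x w + complex_of_real (w \<bullet> v) * f x) \<in> gauss_span R U" if "w \<in> Basis" for w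
        using that by (intro gauss_span.add gauss_span.coord gauss_span.scale f'(2) coord.hyps)
    qed
  next
    case (scale f c)
    then obtain f' where f': "\<And>x. (f has_derivative f' x) (at x)" "\<And>v. v \<in> Basis \<Longrightarrow> (\<lambda>x. f' x v) \<in> gauss_span R U"
      by blast
    then show ?case
      by (intro exI[of _ "\<lambda>x v. c * f' x v"]) (auto intro: has_derivative_mult_right gauss_span.scale)
  next
    case (add f g)
    then obtain f' g' where f': "\<And>x. (f has_derivative f' x) (at x)" "\<And>v. v \<in> Basis \<Longrightarrow> (\<lambda>x. f' x v) \<in> gauss_span R U"
      and g': "\<And>x. (g has_derivative g' x) (at x)" "\<And>v. v \<in> Basis \<Longrightarrow> (\<lambda>x. g' x v) \<in> gauss_span R U"
      by blast
    then show ?case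
      by (intro exI[of _ "\<lambda>x v. f' x v + g' x v"]) (auto intro: has_derivative_add gauss_span.add)
  qed
next
  fix f :: "'a \<Rightarrow> complex" and N :: nat
  assume "f \<in> gauss_span R U"
  then show "bounded (range (\<lambda>x. (1 + norm x) ^ N *\<^sub>R f x))"
  proof (induction arbitrary: N)
    case (base u)
    obtain B where B: "\<And>x. norm (u x) \<le> B" using bnd[OF base] unfolding bounded_iff by blast
    have "norm ((1 + norm x) ^ N *\<^sub>R (complex_of_real (gauss R x) * u x)) \<le> (fact N * exp (1 + R\<^sup>2 / 2)) * B" for x
      using mult_mono[OF power_gauss_bounded[OF R, of x N] B[of x]] by (simp add: norm_mult mult.assoc)
    then show ?case unfolding bounded_iff by blast
  next
    case (coord f v)
    obtain B where B: "\<And>x. norm ((1 + norm x) ^ Suc N *\<^sub>R f x) \<le> B" using coord.IH[of "Suc N"] unfolding bounded_iff by blast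
    have "norm ((1 + norm x) ^ N *\<^sub>R (complex_of_real (x \<bullet> v) * f x)) \<le> norm v * B" for x
    proof -
      have "\<bar>x \<bullet> v\<bar> \<le> (1 + norm x) * norm v"
        using Cauchy_Schwarz_ineq2[of x v] by (simp add: algebra_simps) (smt (verit) norm_ge_zero)
      then have "norm ((1 + norm x) ^ N *\<^sub>R (complex_of_real (x \<bullet> v) * f x)) \<le> (1 + norm x) ^ N * ((1 + norm x) * norm v * norm (f x))"
        by (auto simp: norm_mult intro!: mult_left_mono mult_right_mono)
      also have "\<dots> = norm v * norm ((1 + norm x) ^ Suc N *\<^sub>R f x)"
        by (simp add: mult_ac)
      also have "\<dots> \<le> norm v * B" using B by (intro mult_left_mono) auto
      finally show ?thesis .
    qed
    then show ?case unfolding bounded_iff by blast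
  next
    case (scale f c)
    obtain B where B: "\<And>x. norm ((1 + norm x) ^ N *\<^sub>R f x) \<le> B" using scale.IH[of N] unfolding bounded_iff by blast
    have "norm ((1 + norm x) ^ N *\<^sub>R (c * f x)) \<le> norm c * B" for x
      using mult_left_mono[OF B[of x], of "norm c"] by (simp add: norm_mult algebra_simps)
    then show ?case unfolding bounded_iff by blast
  next
    case (add f g)
    show ?case
      using bounded_plus_comp[OF add.IH(1)[of N] add.IH(2)[of N]] by (simp add: scaleR_add_right)
  qed
qed

lemma schwartz_gauss:
  assumes "R > 0" shows "schwartz (\<lambda>x. complex_of_real (gauss R x))"
proof -
  have "schwartz (\<lambda>x::'a. complex_of_real (gauss R x) * (\<lambda>_. 1) x)"
    by (rule schwartz_gauss_times[OF assms, of _ "range (\<lambda>c _. c)"]) (auto intro!: exI[of _ "\<lambda>_ _. 0"])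
  then show ?thesis by simp
qed

section \<open>The Fourier transform of an integrable function\<close>

lemma fourier_integrable:
  fixes h :: "'a::euclidean_space \<Rightarrow> complex"
  assumes "integrable lborel h"
  shows "integrable lborel (\<lambda>x. h x * exp (- \<i> * complex_of_real (\<xi> \<bullet> x)))"
proof (rule Bochner_Integration.integrable_bound[OF assms])
  have [measurable]: "h \<in> borel_measurable borel" using assms by (auto dest: borel_measurable_integrable)
  show "(\<lambda>x. h x * exp (- \<i> * complex_of_real (\<xi> \<bullet> x))) \<in> borel_measurable lborel" by measurable
qed (simp add: norm_mult)

lemma norm_fourier_le:
  assumes "integrable lborel h"
  shows "norm (fourier h \<xi>) \<le> (\<integral>x. norm (h x) \<partial>lborel)"
  using integral_norm_bound[of lborel "\<lambda>x. h x * exp (- \<i> * complex_of_real (\<xi> \<bullet> x))"]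
  by (simp add: fourier_def norm_mult)

lemma fourier_measurable:
  assumes [measurable]: "h \<in> borel_measurable borel"
  shows "fourier h \<in> borel_measurable borel"
  unfolding fourier_def[abs_def] by measurable

lemma fourier_multiplication:
  fixes f h :: "'a::euclidean_space \<Rightarrow> complex"
  assumes f: "integrable lborel f" and h: "integrable lborel h"
  shows "(\<integral>x. f x * fourier h x \<partial>lborel) = (\<integral>x. h x * fourier f x \<partial>lborel)"
proof -
  have [measurable]: "f \<in> borel_measurable borel" "h \<in> borel_measurable borel"
    using assms by (auto dest: borel_measurable_integrable)
  let ?F = "\<lambda>x y. f x * (h y * exp (- \<i> * complex_of_real (x \<bullet> y)))"
  have "integrable (lborel \<Otimes>\<^sub>M lborel) (\<lambda>(x, y). ?F x y)"
  proof (rule lborel_pair.Fubini_integrable)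
    show "(\<lambda>(x, y). ?F x y) \<in> borel_measurable (lborel \<Otimes>\<^sub>M lborel)" by measurable
    show "integrable lborel (\<lambda>x. \<integral>y. norm (case (x, y) of (x, y) \<Rightarrow> ?F x y) \<partial>lborel)"
      using f h by (simp add: norm_mult)
    show "AE x in lborel. integrable lborel (\<lambda>y. case (x, y) of (x, y) \<Rightarrow> ?F x y)"
      using fourier_integrable[OF h] by simp
  qed
  from lborel_pair.Fubini_integral[OF this]
  have "(\<integral>y. (\<integral>x. ?F x y \<partial>lborel) \<partial>lborel) = (\<integral>x. (\<integral>y. ?F x y \<partial>lborel) \<partial>lborel)" .
  moreover have "(\<integral>y. ?F x y \<partial>lborel) = f x * fourier h x" for x
    by (simp add: fourier_def)
  moreover have "(\<integral>x. ?F x y \<partial>lborel) = h y * fourier f y" for y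
  proof -
    have "(\<integral>x. ?F x y \<partial>lborel) = (\<integral>x. h y * (f x * exp (- \<i> * complex_of_real (y \<bullet> x))) \<partial>lborel)"
      by (intro Bochner_Integration.integral_cong) (auto simp: inner_commute mult_ac)
    then show ?thesis by (simp add: fourier_def)
  qed
  ultimately show ?thesis by (simp only:)
qed

lemma fourier_orthogonal:
  fixes h :: "'a::euclidean_space \<Rightarrow> complex"
  assumes A: "orthogonal_transformation A" and [measurable]: "h \<in> borel_measurable borel"
    and inv: "\<And>x. h (A x) = h x"
  shows "fourier h (A \<xi>) = fourier h \<xi>"
proof -
  have [measurable]: "A \<in> borel_measurable borel"
    using A orthogonal_transformation_linear linear_continuous_on linear_linear
    by (metis borel_measurable_continuous_onI)
  have "fourier h (A \<xi>) = (\<integral>x. h x * exp (- \<i> * complex_of_real (A \<xi> \<bullet> x)) \<partial>distr lborel borel A)"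
    by (simp add: fourier_def distr_lborel_orthogonal[OF A])
  also have "\<dots> = (\<integral>x. h (A x) * exp (- \<i> * complex_of_real (A \<xi> \<bullet> A x)) \<partial>lborel)"
    by (rule integral_distr) measurable
  also have "\<dots> = fourier h \<xi>"
    using A by (simp add: inv fourier_def orthogonal_transformation_def)
  finally show ?thesis .
qed

text \<open>For \<open>h\<close> of bounded support, differentiation under the integral sign is justified by the quadratic
  Taylor remainder of the exponential, which is uniform on the support of \<open>h\<close>.\<close>

lemma fourier_has_derivative:
  fixes h :: "'a::euclidean_space \<Rightarrow> complex"
  assumes h: "integrable lborel h" and supp: "\<And>x. h x \<noteq> 0 \<Longrightarrow> norm x \<le> B"
  shows "integrable lborel (\<lambda>x. - \<i> * complex_of_real (v \<bullet> x) * h x)"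
    and "(fourier h has_derivative (\<lambda>v. fourier (\<lambda>x. - \<i> * complex_of_real (v \<bullet> x) * h x) \<xi>)) (at \<xi>)"
proof -
  let ?I = "\<integral>x. norm (h x) \<partial>lborel"
  let ?d = "\<lambda>v x. - \<i> * complex_of_real (v \<bullet> x) * h x"
  have m [measurable]: "h \<in> borel_measurable borel" using h by (auto dest: borel_measurable_integrable)
  have le: "\<bar>v \<bullet> x\<bar> * norm (h x) \<le> (norm v * B) * norm (h x)" for v x
  proof (cases "h x = 0")
    case False
    have "\<bar>v \<bullet> x\<bar> \<le> norm v * norm x" by (rule Cauchy_Schwarz_ineq2)
    also have "\<dots> \<le> norm v * B" using supp[OF False] by (intro mult_left_mono) auto
    finally show ?thesis by (rule mult_right_mono) simp
  qed simp
  have le2: "(v \<bullet> x)\<^sup>2 * norm (h x) \<le> (norm v * B)\<^sup>2 * norm (h x)" for v x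
  proof (cases "h x = 0")
    case False
    have "\<bar>v \<bullet> x\<bar> \<le> norm v * norm x" by (rule Cauchy_Schwarz_ineq2)
    also have "\<dots> \<le> norm v * B" using supp[OF False] by (intro mult_left_mono) auto
    finally have "(v \<bullet> x)\<^sup>2 \<le> (norm v * B)\<^sup>2" using abs_le_square_iff[of "v \<bullet> x" "norm v * B"] by simp
    then show ?thesis by (rule mult_right_mono) simp
  qed simp
  have int: "integrable lborel (?d v)" for v
  proof (rule Bochner_Integration.integrable_bound)
    show "integrable lborel (\<lambda>x. (norm v * B) * norm (h x))" using h by simp
    show "AE x in lborel. norm (?d v x) \<le> norm ((norm v * B) * norm (h x))"
      using le[of v] by (intro AE_I2) (simp add: norm_mult, smt (verit))
  qed measurable
  then show "integrable lborel (?d v)" .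
  note ints = fourier_integrable[OF int] fourier_integrable[OF h]
  have bound: "norm (fourier (?d v) \<xi>) \<le> norm v * (B * ?I)" for v
  proof -
    have "norm (fourier (?d v) \<xi>) \<le> (\<integral>x. norm (?d v x) \<partial>lborel)"
      by (rule norm_fourier_le[OF int])
    also have "\<dots> \<le> (\<integral>x. (norm v * B) * norm (h x) \<partial>lborel)"
      using le[of v] h by (intro integral_mono integrable_norm int) (auto simp: norm_mult)
    finally show ?thesis by simp
  qed
  have add: "fourier (?d (u + w)) \<xi> = fourier (?d u) \<xi> + fourier (?d w) \<xi>" for u w
    unfolding fourier_def
    by (subst Bochner_Integration.integral_add[OF ints(1) ints(1), symmetric]) (simp add: inner_add_left algebra_simps)
  have scale: "fourier (?d (c *\<^sub>R w)) \<xi> = c *\<^sub>R fourier (?d w) \<xi>" for c w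
    unfolding fourier_def
    by (subst integral_scaleR_right[symmetric]) (auto intro!: Bochner_Integration.integral_cong simp: scaleR_conv_of_real algebra_simps)
  show "(fourier h has_derivative (\<lambda>v. fourier (?d v) \<xi>)) (at \<xi>)"
  proof (rule has_derivativeI_sandwich[where e = 1])
    show "bounded_linear (\<lambda>v. fourier (?d v) \<xi>)"
      by (rule bounded_linear_intro[OF add scale bound])
    show "((\<lambda>y. norm (y - \<xi>) * (B\<^sup>2 * ?I / 2)) \<longlongrightarrow> 0) (at \<xi>)"
      by (auto intro!: tendsto_eq_intros)
    fix y assume "y \<noteq> \<xi>"
    define v where "v = y - \<xi>"
    have y: "y = \<xi> + v" by (simp add: v_def)
    let ?e = "\<lambda>x. exp (- \<i> * complex_of_real (\<xi> \<bullet> x))"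
    let ?D = "\<lambda>x. h x * exp (- \<i> * complex_of_real (y \<bullet> x)) - h x * ?e x - ?d v x * ?e x"
    have iD: "integrable lborel ?D" by (intro Bochner_Integration.integrable_diff ints)
    have D: "norm (?D x) \<le> ((norm v * B)\<^sup>2 / 2) * norm (h x)" for x
    proof -
      \<comment> \<open>The integrand is \<open>h\<close> times a character times the first order remainder of \<open>exp (i t)\<close>.\<close>
      let ?t = "- (v \<bullet> x)"
      have "?D x = h x * ?e x * (iexp ?t - (\<Sum>k\<le>1. (\<i> * ?t) ^ k / fact k))"
        unfolding y by (simp add: inner_add_left ring_distribs exp_add exp_diff exp_minus field_simps)
      then have "norm (?D x) = norm (h x) * norm (iexp ?t - (\<Sum>k\<le>1. (\<i> * ?t) ^ k / fact k))"
        by (simp add: norm_mult)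
      also have "\<dots> \<le> norm (h x) * (\<bar>?t\<bar> ^ Suc 1 / fact (Suc 1))"
        by (intro mult_left_mono iexp_approx1) auto
      also have "\<dots> = ((v \<bullet> x)\<^sup>2 * norm (h x)) / 2" by (simp add: power2_eq_square)
      also have "\<dots> \<le> ((norm v * B)\<^sup>2 * norm (h x)) / 2" using le2[of v x] by simp
      finally show ?thesis by simp
    qed
    have "fourier h y - fourier h \<xi> - fourier (?d v) \<xi> = (\<integral>x. ?D x \<partial>lborel)"
      using Bochner_Integration.integral_diff[OF Bochner_Integration.integrable_diff[OF ints(2)[of y] ints(2)[of \<xi>]] ints(1)[of v \<xi>]]
        Bochner_Integration.integral_diff[OF ints(2)[of y] ints(2)[of \<xi>]]
      by (simp only: fourier_def)
    then have "norm (fourier h y - fourier h \<xi> - fourier (?d v) \<xi>) \<le> (\<integral>x. norm (?D x) \<partial>lborel)"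
      using integral_norm_bound[of lborel ?D] by simp
    also have "\<dots> \<le> (\<integral>x. ((norm v * B)\<^sup>2 / 2) * norm (h x) \<partial>lborel)"
      using D h iD by (intro integral_mono) auto
    also have "\<dots> = norm v * (norm v * (B\<^sup>2 * ?I / 2))" by (simp add: power2_eq_square)
    finally show "norm (fourier h y - fourier h \<xi> - fourier (?d (y - \<xi>)) \<xi>) / norm (y - \<xi>) \<le> norm (y - \<xi>) * (B\<^sup>2 * ?I / 2)"
      using \<open>y \<noteq> \<xi>\<close> unfolding v_def by (simp add: divide_le_eq mult.commute)
  qed simp
qed

lemma schwartz_gauss_times_fourier:
  fixes h :: "'a::euclidean_space \<Rightarrow> complex"
  assumes R: "R > 0" and h: "integrable lborel h" and supp: "\<And>x. h x \<noteq> 0 \<Longrightarrow> norm x \<le> B"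
  shows "schwartz (\<lambda>x. complex_of_real (gauss R x) * fourier h x)"
proof (rule schwartz_gauss_times[OF R, where U = "fourier ` {h. integrable lborel h \<and> (\<forall>x. h x \<noteq> 0 \<longrightarrow> norm x \<le> B)}"])
  let ?H = "{h :: 'a \<Rightarrow> complex. integrable lborel h \<and> (\<forall>x. h x \<noteq> 0 \<longrightarrow> norm x \<le> B)}"
  show "fourier h \<in> fourier ` ?H" using assms by auto
  fix u :: "'a \<Rightarrow> complex" assume "u \<in> fourier ` ?H"
  then obtain g where u: "u = fourier g" and g: "integrable lborel g" "\<And>x. g x \<noteq> 0 \<Longrightarrow> norm x \<le> B" by auto
  show "\<exists>u'. (\<forall>x. (u has_derivative u' x) (at x)) \<and> (\<forall>v\<in>Basis. (\<lambda>x. u' x v) \<in> fourier ` ?H)"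
    unfolding u
    by (intro exI[of _ "\<lambda>\<xi> v. fourier (\<lambda>x. - \<i> * complex_of_real (v \<bullet> x) * g x) \<xi>"] conjI allI ballI
         fourier_has_derivative(2)[OF g] imageI) (use fourier_has_derivative(1)[OF g] g(2) in auto)
  show "bounded (range u)"
    unfolding u bounded_iff using norm_fourier_le[OF g(1)] by blast
qed

section \<open>Packets with frequencies near the unit sphere\<close>

definition shell :: "real \<Rightarrow> 'a::euclidean_space set" where
  "shell R = {\<omega>. \<bar>norm \<omega> - 1\<bar> \<le> 1 / R}"

definition packet :: "real \<Rightarrow> 'a::euclidean_space \<Rightarrow> complex" where
  "packet R x = complex_of_real (gauss R x) * fourier (indicator (shell R)) x"

lemma shell_sets [measurable]: "shell R \<in> sets borel"
  unfolding shell_def by measurable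

lemma shell_subset_cball: "shell R \<subseteq> cball 0 (1 + 1 / R)"
  by (auto simp: shell_def)

lemma emeasure_shell_finite: "emeasure lborel (shell R :: 'a::euclidean_space set) < \<infinity>"
proof -
  have "emeasure lborel (shell R :: 'a set) \<le> emeasure lborel (cball (0::'a) (1 + 1 / R))"
    by (rule emeasure_mono[OF shell_subset_cball]) simp
  then show ?thesis using emeasure_lborel_cball_finite[of "0::'a" "1 + 1 / R"] by (rule le_less_trans)
qed

lemma shell_integrable [simp]: "integrable lborel (indicator (shell R) :: 'a::euclidean_space \<Rightarrow> complex)"
proof -
  have "integrable lborel (\<lambda>x::'a. complex_of_real (indicator (shell R) x))"
    using emeasure_shell_finite[of R] by (intro integrable_of_real integrable_real_indicator) auto
  moreover have "(\<lambda>x::'a. complex_of_real (indicator (shell R) x)) = indicator (shell R)"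
    by (auto simp: indicator_def)
  ultimately show ?thesis by simp
qed

text \<open>The mean value inequality for powers. It serves both for the volume of the shell and for
  \<open>power_sum_block_le\<close>.\<close>

lemma power_diff_le:
  fixes x y :: real assumes "0 \<le> y" "y \<le> x"
  shows "x ^ n - y ^ n \<le> real n * (x - y) * x ^ (n - 1)"
proof (induction n)
  case (Suc n)
  show ?case
  proof (cases n)
    case (Suc k)
    have "x ^ Suc n - y ^ Suc n = x * (x ^ n - y ^ n) + (x - y) * y ^ n" by (simp add: algebra_simps)
    also have "\<dots> \<le> x * (real n * (x - y) * x ^ (n - 1)) + (x - y) * x ^ n"
      using assms Suc.IH by (intro add_mono mult_left_mono power_mono) auto
    also have "\<dots> = real (Suc n) * (x - y) * x ^ (Suc n - 1)"
      using Suc by (simp add: algebra_simps)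
    finally show ?thesis .
  qed simp
qed simp

definition shell_const :: "nat \<Rightarrow> real" where
  "shell_const n = unit_ball_vol (real n) * real n * 2 ^ n"

lemma measure_shell_le:
  assumes R: "R \<ge> 1"
  shows "measure lborel (shell R :: 'a::euclidean_space set) \<le> shell_const DIM('a) / R"
proof -
  let ?n = "DIM('a)" and ?B = "cball (0::'a) (1 + 1 / R)" and ?b = "ball (0::'a) (1 - 1 / R)"
  have sub: "?b \<subseteq> ?B" using R by (intro order_trans[OF ball_subset_cball] subset_cball) simp
  have "measure lborel (shell R :: 'a set) \<le> measure lborel (?B - ?b)"
  proof (rule measure_mono_fmeasurable)
    have "emeasure lborel (?B - ?b) \<le> emeasure lborel ?B" by (rule emeasure_mono) auto
    then have "emeasure lborel (?B - ?b) < \<infinity>"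
      using emeasure_lborel_cball_finite by (rule le_less_trans)
    then show "?B - ?b \<in> fmeasurable lborel"
      by (intro fmeasurableI) auto
  qed (auto simp: shell_def)
  also have "\<dots> = measure lborel ?B - measure lborel ?b"
    by (rule measure_Diff[OF less_imp_neq[OF emeasure_lborel_cball_finite]]) (use sub in auto)
  also have "\<dots> = unit_ball_vol (real ?n) * ((1 + 1 / R) ^ ?n - (1 - 1 / R) ^ ?n)"
    using R by (simp add: content_ball content_cball right_diff_distrib)
  also have "\<dots> \<le> unit_ball_vol (real ?n) * (real ?n * ((1 + 1 / R) - (1 - 1 / R)) * (1 + 1 / R) ^ (?n - 1))"
    using R by (intro mult_left_mono power_diff_le) auto
  also have "\<dots> \<le> unit_ball_vol (real ?n) * (real ?n * ((1 + 1 / R) - (1 - 1 / R)) * 2 ^ (?n - 1))"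
    using R by (intro mult_left_mono power_mono) auto
  also have "\<dots> = unit_ball_vol (real ?n) * real ?n * (2 * 2 ^ (?n - 1)) / R"
    by simp
  also have "2 * 2 ^ (?n - 1) = (2 ^ ?n :: real)"
    by (cases "DIM('a)") auto
  finally show ?thesis by (simp add: shell_const_def)
qed

lemma fourier_shell_orthogonal:
  fixes A :: "'a::euclidean_space \<Rightarrow> 'a"
  assumes "orthogonal_transformation A"
  shows "fourier (indicator (shell R)) (A \<xi>) = fourier (indicator (shell R)) \<xi>"
  using fourier_orthogonal[OF assms, of "indicator (shell R)"] assms
  by (simp add: shell_def indicator_def orthogonal_transformation_norm)

lemma packet_orthogonal:
  fixes A :: "'a::euclidean_space \<Rightarrow> 'a"
  assumes "orthogonal_transformation A"
  shows "packet R (A x) = packet R x"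
  using assms by (simp add: packet_def fourier_shell_orthogonal gauss_def orthogonal_transformation_norm)

lemma schwartz_packet: "R > 0 \<Longrightarrow> schwartz (packet R)"
  unfolding packet_def[abs_def]
  by (rule schwartz_gauss_times_fourier[OF _ shell_integrable, where B = "1 + 1 / R"])
     (use shell_subset_cball[of R] in \<open>auto simp: indicator_def split: if_splits\<close>)

text \<open>The shell is symmetric under \<open>\<omega> \<mapsto> - \<omega>\<close>.\<close>

lemma fourier_shell_real: "fourier (indicator (shell R)) \<xi> \<in> \<real>"
proof -
  have "orthogonal_transformation (uminus :: 'a \<Rightarrow> 'a)"
    by (auto simp: orthogonal_transformation_def intro!: linearI)
  then have "fourier (indicator (shell R)) (- \<xi>) = fourier (indicator (shell R)) \<xi>"
    by (rule fourier_shell_orthogonal)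
  moreover have "cnj (fourier (indicator (shell R)) \<xi>) = fourier (indicator (shell R)) (- \<xi>)"
    unfolding fourier_def Bochner_Integration.integral_cnj[symmetric] complex_cnj_mult exp_cnj
    by (intro Bochner_Integration.integral_cong) (auto simp: indicator_def)
  ultimately show ?thesis by (simp add: Reals_cnj_iff)
qed

lemma norm_fourier_shell_le:
  assumes "R \<ge> 1"
  shows "norm (fourier (indicator (shell R)) (\<xi>::'a::euclidean_space)) \<le> shell_const DIM('a) / R"
proof -
  have "norm (fourier (indicator (shell R)) \<xi>) \<le> (\<integral>x. norm (indicator (shell R) x :: complex) \<partial>(lborel :: 'a measure))"
    by (rule norm_fourier_le) simp
  also have "\<dots> = (\<integral>x. indicator (shell R) x \<partial>(lborel :: 'a measure))"
    by (intro Bochner_Integration.integral_cong) (auto simp: indicator_def)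
  also have "\<dots> = measure lborel (shell R :: 'a set)" by simp
  also have "\<dots> \<le> shell_const DIM('a) / R" using assms by (rule measure_shell_le)
  finally show ?thesis .
qed

lemma integrable_packet:
  assumes "R > 0" shows "integrable lborel (packet R :: 'a::euclidean_space \<Rightarrow> complex)"
proof (rule Bochner_Integration.integrable_bound)
  let ?c = "\<integral>x. norm (indicator (shell R) x :: complex) \<partial>(lborel :: 'a measure)"
  show "integrable lborel (\<lambda>x::'a. ?c * gauss R x)"
    using has_bochner_integral_gauss[OF assms, where 'a='a] by (simp add: has_bochner_integral_iff)
  show "(packet R :: 'a \<Rightarrow> complex) \<in> borel_measurable lborel"
    unfolding packet_def[abs_def] using fourier_measurable[of "indicator (shell R) :: 'a \<Rightarrow> complex"] by measurable
  show "AE x in (lborel :: 'a measure). norm (packet R x) \<le> norm (?c * gauss R x)"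
  proof (intro AE_I2)
    fix x :: 'a
    have "norm (packet R x) \<le> ?c * gauss R x"
      using mult_right_mono[OF norm_fourier_le[OF shell_integrable[of R], of x] gauss_nonneg[of R x]]
      by (simp add: packet_def norm_mult mult.commute)
    then show "norm (packet R x) \<le> norm (?c * gauss R x)" by simp
  qed
qed

text \<open>This is the convolution of the indicator of the shell with the transform of the Gaussian, as
  \<open>fourier_packet\<close> shows. The sign in \<open>\<xi> + \<omega>\<close> comes from defining the packet by the Fourier
  transform of the indicator rather than by its inverse.\<close>

definition packet_hat :: "real \<Rightarrow> 'a::euclidean_space \<Rightarrow> real" where
  "packet_hat R \<xi> = (\<integral>\<omega>. indicator (shell R) \<omega> * ((sqrt (2 * pi) * R) ^ DIM('a) * gauss (1 / R) (\<xi> + \<omega>)) \<partial>lborel)"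

lemma fourier_packet:
  fixes \<xi> :: "'a::euclidean_space"
  assumes R: "R > 0"
  shows "fourier (packet R) \<xi> = complex_of_real (packet_hat R \<xi>)"
proof -
  let ?g = "\<lambda>x. complex_of_real (gauss R x) * exp (- \<i> * complex_of_real (\<xi> \<bullet> x))"
  have g: "integrable lborel ?g"
    using has_bochner_integral_gauss_character[OF R, of \<xi>] by (simp add: has_bochner_integral_iff)
  have "fourier (packet R) \<xi> = (\<integral>x. ?g x * fourier (indicator (shell R)) x \<partial>lborel)"
    unfolding fourier_def[of "packet R"] by (intro Bochner_Integration.integral_cong) (auto simp: packet_def)
  also have "\<dots> = (\<integral>\<omega>. indicator (shell R) \<omega> * fourier ?g \<omega> \<partial>lborel)"
    using g by (rule fourier_multiplication) simp
  also have "\<dots> = (\<integral>\<omega>. complex_of_real (indicator (shell R) \<omega> * ((sqrt (2 * pi) * R) ^ DIM('a) * gauss (1 / R) (\<xi> + \<omega>))) \<partial>lborel)"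
  proof (intro Bochner_Integration.integral_cong refl)
    fix \<omega> :: 'a
    have "fourier ?g \<omega> = fourier (\<lambda>x. complex_of_real (gauss R x)) (\<xi> + \<omega>)"
      unfolding fourier_def
      by (intro Bochner_Integration.integral_cong) (auto simp: inner_add_left ring_distribs exp_add exp_diff exp_minus field_simps)
    then show "indicator (shell R) \<omega> * fourier ?g \<omega> = complex_of_real (indicator (shell R) \<omega> * ((sqrt (2 * pi) * R) ^ DIM('a) * gauss (1 / R) (\<xi> + \<omega>)))"
      using fourier_gauss[OF R, of "\<xi> + \<omega>"] by (simp add: indicator_def)
  qed
  also have "\<dots> = complex_of_real (packet_hat R \<xi>)"
    by (simp only: packet_hat_def integral_complex_of_real)
  finally show ?thesis .
qed

text \<open>The total mass does not depend on \<open>R\<close>, because the transform of a Gaussian of height \<open>1\<close> has a fixed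
  integral. This gives the upper bound for \<open>packet_hat\<close>, uniform in \<open>R\<close>.\<close>

lemma has_bochner_integral_shifted_gauss:
  fixes \<xi> :: "'a::euclidean_space"
  assumes R: "R > 0"
  shows "has_bochner_integral lborel (\<lambda>\<omega>. (sqrt (2 * pi) * R) ^ DIM('a) * gauss (1 / R) (\<xi> + \<omega>)) ((2 * pi) ^ DIM('a))"
proof -
  have "has_bochner_integral (distr lborel borel ((+) \<xi>)) (gauss (1 / R)) ((sqrt (2 * pi) * (1 / R)) ^ DIM('a))"
    using has_bochner_integral_gauss[of "1 / R", where 'a='a] R by (simp add: lborel_distr_plus)
  then have "has_bochner_integral lborel (\<lambda>\<omega>. gauss (1 / R) (\<xi> + \<omega>)) ((sqrt (2 * pi) * (1 / R)) ^ DIM('a))"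
    by (simp add: has_bochner_integral_iff integrable_distr_eq integral_distr)
  then have "has_bochner_integral lborel (\<lambda>\<omega>. (sqrt (2 * pi) * R) ^ DIM('a) * gauss (1 / R) (\<xi> + \<omega>))
     ((sqrt (2 * pi) * R) ^ DIM('a) * (sqrt (2 * pi) * (1 / R)) ^ DIM('a))"
    by (rule has_bochner_integral_mult_right)
  moreover have "(sqrt (2 * pi) * R) ^ DIM('a) * (sqrt (2 * pi) * (1 / R)) ^ DIM('a) = (2 * pi) ^ DIM('a)"
    using R unfolding power_mult_distrib[symmetric] by simp
  ultimately show ?thesis by simp
qed

lemma integrable_packet_hat:
  fixes \<xi> :: "'a::euclidean_space"
  assumes R: "R > 0"
  shows "integrable lborel (\<lambda>\<omega>. indicator (shell R) \<omega> * ((sqrt (2 * pi) * R) ^ DIM('a) * gauss (1 / R) (\<xi> + \<omega>)))"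
  using integrable_mult_indicator[OF _ has_bochner_integral_iff[THEN iffD1, THEN conjunct1, OF has_bochner_integral_shifted_gauss[OF R, of \<xi>]], of "shell R"]
  by simp

lemma packet_hat_le:
  fixes \<xi> :: "'a::euclidean_space"
  assumes R: "R > 0"
  shows "packet_hat R \<xi> \<le> (2 * pi) ^ DIM('a)"
proof -
  have "packet_hat R \<xi> \<le> (\<integral>\<omega>. (sqrt (2 * pi) * R) ^ DIM('a) * gauss (1 / R) (\<xi> + \<omega>) \<partial>lborel)"
    unfolding packet_hat_def
    using has_bochner_integral_shifted_gauss[OF R, of \<xi>] R
    by (intro integral_mono integrable_packet_hat) (auto simp: has_bochner_integral_iff indicator_def)
  then show ?thesis
    using has_bochner_integral_shifted_gauss[OF R, of \<xi>] by (simp add: has_bochner_integral_iff)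
qed

lemma packet_hat_nonneg: "R > 0 \<Longrightarrow> 0 \<le> packet_hat R \<xi>"
  unfolding packet_hat_def by (intro integral_nonneg_AE AE_I2) simp

definition packet_const :: "nat \<Rightarrow> real" where
  "packet_const n = sqrt (2 * pi) ^ n * exp (- 2) * unit_ball_vol (real n)"

lemma packet_const_pos: "packet_const n > 0"
  by (simp add: packet_const_def)

text \<open>The ball of radius \<open>1/R\<close> about \<open>- \<xi> / |\<xi>|\<close> lies in the shell, and on it \<open>\<xi> + \<omega>\<close> has
  norm at most \<open>2/R\<close>, where the Gaussian of width \<open>1/R\<close> is at least \<open>exp (- 2)\<close>. The height
  \<open>R\<^sup>n\<close> of the kernel compensates for the volume of the ball.\<close>

lemma packet_hat_ge:
  fixes \<xi> :: "'a::euclidean_space"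
  assumes R: "R > 1" and \<xi>: "\<bar>norm \<xi> - 1\<bar> \<le> 1 / R"
  shows "packet_const DIM('a) \<le> packet_hat R \<xi>"
proof -
  let ?n = "DIM('a)"
  have "\<xi> \<noteq> 0" using assms by auto
  define \<eta> where "\<eta> = - sgn \<xi>"
  have \<eta>: "norm \<eta> = 1" "norm (\<xi> + \<eta>) \<le> 1 / R"
  proof -
    show "norm \<eta> = 1" using \<open>\<xi> \<noteq> 0\<close> by (simp add: \<eta>_def norm_sgn)
    have "\<xi> + \<eta> = (norm \<xi> - 1) *\<^sub>R sgn \<xi>"
      using \<open>\<xi> \<noteq> 0\<close> by (simp add: \<eta>_def sgn_div_norm algebra_simps)
    then show "norm (\<xi> + \<eta>) \<le> 1 / R"
      using \<xi> \<open>\<xi> \<noteq> 0\<close> by (simp add: norm_sgn)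
  qed
  have *: "indicator (ball \<eta> (1 / R)) \<omega> * ((sqrt (2 * pi) * R) ^ ?n * exp (- 2))
      \<le> indicator (shell R) \<omega> * ((sqrt (2 * pi) * R) ^ ?n * gauss (1 / R) (\<xi> + \<omega>))" for \<omega>
  proof (cases "\<omega> \<in> ball \<eta> (1 / R)")
    case True
    then have d: "norm (\<omega> - \<eta>) < 1 / R" by (simp add: dist_norm norm_minus_commute)
    have "\<bar>norm \<omega> - 1\<bar> \<le> norm (\<omega> - \<eta>)" using norm_triangle_ineq3[of \<omega> \<eta>] \<eta> by simp
    then have s: "\<omega> \<in> shell R" using d by (simp add: shell_def)
    have "norm (\<xi> + \<omega>) \<le> norm (\<xi> + \<eta>) + norm (\<omega> - \<eta>)"
      using norm_triangle_ineq[of "\<xi> + \<eta>" "\<omega> - \<eta>"] by simp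
    then have "norm (\<xi> + \<omega>) \<le> 2 / R" using d \<eta>(2) by simp
    then have "(norm (\<xi> + \<omega>))\<^sup>2 \<le> (2 / R)\<^sup>2" by (intro power_mono) auto
    then have "exp (- 2) \<le> gauss (1 / R) (\<xi> + \<omega>)"
      using R by (simp add: gauss_def power_divide field_simps)
    then show ?thesis using s R by (simp add: indicator_def)
  qed (use R in simp)
  have "packet_const ?n = (\<integral>\<omega>. indicator (ball \<eta> (1 / R)) \<omega> * ((sqrt (2 * pi) * R) ^ ?n * exp (- 2)) \<partial>lborel)"
    using R by (simp add: packet_const_def content_ball power_mult_distrib power_divide)
  also have "\<dots> \<le> packet_hat R \<xi>"
    unfolding packet_hat_def using R
    by (intro integral_mono integrable_packet_hat *) (auto simp: emeasure_ball)
  finally show ?thesis .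
qed

text \<open>The transform \<open>u\<close> of the shell is real, so the integrand is \<open>f\<^sub>R u\<close>. The multiplication formula moves
  the transform onto the packet and turns the integral into that of \<open>packet_hat R\<close> over the shell,
  a bounded function on a set of measure \<open>O(1/R)\<close>.\<close>

lemma packet_energy:
  assumes R: "R \<ge> 1"
  shows "(\<integral>\<^sup>+x. ennreal (gauss R x * (norm (fourier (indicator (shell R)) x))\<^sup>2) \<partial>(lborel :: 'a::euclidean_space measure))
     \<le> ennreal ((2 * pi) ^ DIM('a) * shell_const DIM('a) / R)"
proof -
  let ?u = "fourier (indicator (shell R)) :: 'a \<Rightarrow> complex" and ?n = "DIM('a)"
  let ?e = "\<lambda>x. gauss R x * (norm (?u x))\<^sup>2"
  have R0: "R > 0" using R by simp
  have e: "complex_of_real (?e x) = packet R x * ?u x" for x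
  proof -
    obtain r where "?u x = complex_of_real r" using fourier_shell_real[of R x] by (auto elim: Reals_cases)
    then show ?thesis by (simp add: packet_def power2_eq_square)
  qed
  have [measurable]: "?u \<in> borel_measurable borel" by (rule fourier_measurable) simp
  have ie: "integrable lborel ?e"
  proof (rule Bochner_Integration.integrable_bound)
    show "integrable lborel (\<lambda>x::'a. (shell_const ?n / R)\<^sup>2 * gauss R x)"
      using has_bochner_integral_gauss[OF R0, where 'a='a] by (simp add: has_bochner_integral_iff)
    show "?e \<in> borel_measurable lborel" by measurable
    show "AE x in lborel. norm (?e x) \<le> norm ((shell_const ?n / R)\<^sup>2 * gauss R x)"
    proof (intro AE_I2)
      fix x
      have "(norm (?u x))\<^sup>2 \<le> (shell_const ?n / R)\<^sup>2"
        using norm_fourier_shell_le[OF R, of x] by (intro power_mono) auto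
      then show "norm (?e x) \<le> norm ((shell_const ?n / R)\<^sup>2 * gauss R x)"
        using mult_right_mono[of "(norm (?u x))\<^sup>2" "(shell_const ?n / R)\<^sup>2" "gauss R x"] by (simp add: abs_mult mult.commute)
    qed
  qed
  have "complex_of_real (\<integral>x. ?e x \<partial>lborel) = (\<integral>x. packet R x * ?u x \<partial>lborel)"
    by (simp only: e[symmetric] integral_complex_of_real)
  also have "\<dots> = (\<integral>\<omega>. indicator (shell R) \<omega> * fourier (packet R) \<omega> \<partial>(lborel :: 'a measure))"
    using integrable_packet[OF R0] by (rule fourier_multiplication) simp
  also have "\<dots> = (\<integral>\<omega>. complex_of_real (indicator (shell R) \<omega> * packet_hat R \<omega>) \<partial>(lborel :: 'a measure))"
    by (intro Bochner_Integration.integral_cong) (auto simp: fourier_packet[OF R0] indicator_def)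
  also have "\<dots> = complex_of_real (\<integral>\<omega>. indicator (shell R) \<omega> * packet_hat R \<omega> \<partial>(lborel :: 'a measure))"
    by (rule integral_complex_of_real)
  finally have eq: "(\<integral>x. ?e x \<partial>lborel) = (\<integral>\<omega>. indicator (shell R) \<omega> * packet_hat R \<omega> \<partial>(lborel :: 'a measure))"
    by (simp only: of_real_eq_iff)
  have "(\<integral>\<omega>. indicator (shell R) \<omega> * packet_hat R \<omega> \<partial>(lborel :: 'a measure)) \<le> (\<integral>\<omega>. indicator (shell R) \<omega> * (2 * pi) ^ ?n \<partial>(lborel :: 'a measure))"
  proof (intro integral_mono_AE' AE_I2)
    show "integrable lborel (\<lambda>\<omega>::'a. indicator (shell R) \<omega> * (2 * pi) ^ ?n)"
      using emeasure_shell_finite[where 'a='a, of R] by (intro integrable_mult_left integrable_real_indicator) auto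
  qed (use packet_hat_le[OF R0] packet_hat_nonneg[OF R0] in \<open>auto simp: indicator_def\<close>)
  also have "\<dots> = measure lborel (shell R :: 'a set) * (2 * pi) ^ ?n"
    by simp
  also have "\<dots> \<le> shell_const ?n / R * (2 * pi) ^ ?n"
    by (intro mult_right_mono measure_shell_le R) simp
  finally have "(\<integral>x. ?e x \<partial>lborel) \<le> (2 * pi) ^ ?n * shell_const ?n / R"
    by (simp add: eq mult.commute)
  then show ?thesis
    using ie by (subst nn_integral_eq_integral) (auto intro: ennreal_leI)
qed

section \<open>The size of packets in Lebesgue spaces\<close>

definition energy_const :: "nat \<Rightarrow> real" where
  "energy_const n = (2 * pi) ^ n * shell_const n"

lemma shell_const_nonneg: "shell_const n \<ge> 0" and energy_const_nonneg: "energy_const n \<ge> 0"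
  by (simp_all add: shell_const_def energy_const_def)

lemma norm_packet: "norm (packet R x) = gauss R x * norm (fourier (indicator (shell R)) x)"
  by (simp add: packet_def norm_mult)

lemma fourier_shell_measurable [measurable]:
  "(fourier (indicator (shell R)) :: 'a::euclidean_space \<Rightarrow> complex) \<in> borel_measurable borel"
  by (rule fourier_measurable) simp

lemma packet_measurable [measurable]: "packet R \<in> borel_measurable borel"
  unfolding packet_def[abs_def] by measurable

lemma nn_integral_gauss:
  assumes "R > 0"
  shows "(\<integral>\<^sup>+x. ennreal (gauss R x) \<partial>(lborel :: 'a::euclidean_space measure)) = ennreal ((sqrt (2 * pi) * R) ^ DIM('a))"
  using has_bochner_integral_gauss[OF assms, where 'a='a]
  by (subst nn_integral_eq_integral) (auto simp: has_bochner_integral_iff)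

lemma norm_packet_le:
  assumes "R \<ge> 1"
  shows "norm (packet R (x::'a::euclidean_space)) \<le> shell_const DIM('a) / R"
proof -
  have "norm (packet R x) \<le> 1 * (shell_const DIM('a) / R)"
    unfolding norm_packet by (intro mult_mono gauss_le_1 norm_fourier_shell_le assms) auto
  then show ?thesis by simp
qed

text \<open>The packet is bounded by \<open>1\<close>, so that its \<open>p\<close>-th power is at most its square.\<close>

lemma packet_Lp_high:
  assumes R: "R \<ge> 1" "shell_const DIM('a) \<le> R" and p: "p \<ge> 2"
  shows "(\<integral>\<^sup>+x. ennreal (norm (packet R x) powr p) \<partial>(lborel :: 'a::euclidean_space measure))
     \<le> ennreal (energy_const DIM('a) / R)"
proof -
  have "norm (packet R x) powr p \<le> gauss R x * (norm (fourier (indicator (shell R)) x))\<^sup>2" for x :: 'a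
  proof -
    have "norm (packet R x) \<le> 1"
      using norm_packet_le[OF R(1), of x] R by (simp add: order_trans[OF norm_packet_le])
    then have "norm (packet R x) powr p \<le> norm (packet R x) powr 2"
      using p by (intro powr_mono') auto
    also have "\<dots> = (norm (packet R x))\<^sup>2" by simp
    also have "\<dots> = gauss R x * (gauss R x * (norm (fourier (indicator (shell R)) x))\<^sup>2)"
      by (simp add: norm_packet power2_eq_square)
    also have "\<dots> \<le> 1 * (gauss R x * (norm (fourier (indicator (shell R)) x))\<^sup>2)"
      by (intro mult_right_mono gauss_le_1) auto
    finally show ?thesis by simp
  qed
  then have "(\<integral>\<^sup>+x. ennreal (norm (packet R x) powr p) \<partial>(lborel :: 'a measure))
     \<le> (\<integral>\<^sup>+x. ennreal (gauss R x * (norm (fourier (indicator (shell R)) x))\<^sup>2) \<partial>(lborel :: 'a measure))"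
    by (intro nn_integral_mono ennreal_leI)
  also have "\<dots> \<le> ennreal (energy_const DIM('a) / R)"
    using packet_energy[OF R(1), where 'a='a] by (simp add: energy_const_def)
  finally show ?thesis .
qed

lemma weighted_geometric_mean_le_add:
  fixes x y :: real
  assumes "x \<ge> 0" "y \<ge> 0" "0 \<le> \<theta>" "\<theta> \<le> 1"
  shows "x powr \<theta> * y powr (1 - \<theta>) \<le> x + y"
proof -
  let ?M = "max x y"
  have "x powr \<theta> * y powr (1 - \<theta>) \<le> ?M powr \<theta> * ?M powr (1 - \<theta>)"
    using assms by (intro mult_mono powr_mono2) auto
  also have "\<dots> = ?M powr 1" by (subst powr_add[symmetric]) simp
  also have "\<dots> \<le> x + y" using assms by (simp add: max_def)
  finally show ?thesis .
qed

text \<open>Write \<open>t\<close> for the absolute value of the transform of the shell and \<open>g\<close> for the Gaussian. As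
  \<open>g \<le> 1 \<le> p\<close>, \<open>|f\<^sub>R|\<^sup>p\<close> is at most \<open>g t\<^sup>p = (g t\<^sup>2)\<^bsup>p/2\<^esup> g\<^bsup>1 - p/2\<^esup>\<close>, a weighted geometric
  mean of the energy density and the Gaussian. The weights \<open>a\<close> and \<open>b\<close> in the proof make the two
  integrals comparable in \<open>R\<close>.\<close>

lemma packet_Lp_low:
  assumes R: "R \<ge> 1" and p: "1 \<le> p" "p \<le> 2"
  shows "(\<integral>\<^sup>+x. ennreal (norm (packet R x) powr p) \<partial>(lborel :: 'a::euclidean_space measure))
     \<le> ennreal ((energy_const DIM('a) + sqrt (2 * pi) ^ DIM('a)) * R powr (real DIM('a) - p * (real DIM('a) + 1) / 2))"
proof -
  let ?n = "real DIM('a)"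
  \<comment> \<open>Normalized so that the weighted geometric mean of \<open>a\<close> and \<open>b\<close> is \<open>1\<close>.\<close>
  define a b where "a = R powr ((?n + 1) * (1 - p / 2))" and "b = R powr (- p * (?n + 1) / 2)"
  let ?t = "\<lambda>x::'a. norm (fourier (indicator (shell R)) x)"
  have ab: "a > 0" "b > 0" "a powr (p / 2) * b powr (1 - p / 2) = 1"
  proof -
    show "a > 0" "b > 0" using R by (auto simp: a_def b_def)
    have "(?n + 1) * (1 - p / 2) * (p / 2) + (- p * (?n + 1) / 2) * (1 - p / 2) = 0" by (simp add: field_simps)
    then show "a powr (p / 2) * b powr (1 - p / 2) = 1"
      using R by (simp add: a_def b_def powr_powr flip: powr_add)
  qed
  have pw: "norm (packet R x) powr p \<le> a * (gauss R x * (?t x)\<^sup>2) + b * gauss R x" for x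
  proof -
    let ?g = "gauss R x"
    have "norm (packet R x) powr p = ?g powr p * ?t x powr p"
      by (simp add: norm_packet powr_mult)
    also have "\<dots> \<le> ?g powr 1 * ?t x powr p"
      using p by (intro mult_right_mono powr_mono' gauss_le_1) auto
    also have "\<dots> = (a powr (p / 2) * b powr (1 - p / 2)) * (?g powr (p / 2) * ?g powr (1 - p / 2)) * ((?t x powr 2) powr (p / 2))"
    proof -
      have 1: "(?t x powr 2) powr (p / 2) = ?t x powr p" unfolding powr_powr by simp
      have 2: "?g powr (p / 2) * ?g powr (1 - p / 2) = ?g powr 1" by (subst powr_add[symmetric]) simp
      show ?thesis by (simp only: ab(3) 1 2 mult_1_left)
    qed
    also have "\<dots> = (a * (?g * (?t x)\<^sup>2)) powr (p / 2) * (b * ?g) powr (1 - p / 2)"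
      using ab by (simp add: powr_mult)
    also have "\<dots> \<le> a * (?g * (?t x)\<^sup>2) + b * ?g"
      using ab p by (intro weighted_geometric_mean_le_add) auto
    finally show ?thesis .
  qed
  have "(\<integral>\<^sup>+x. ennreal (norm (packet R x) powr p) \<partial>(lborel :: 'a measure))
     \<le> (\<integral>\<^sup>+x. ennreal a * ennreal (gauss R x * (?t x)\<^sup>2) + ennreal b * ennreal (gauss R x) \<partial>lborel)"
    using pw ab by (intro nn_integral_mono) (simp add: ennreal_leI flip: ennreal_mult ennreal_plus)
  also have "\<dots> = ennreal a * (\<integral>\<^sup>+x. ennreal (gauss R x * (?t x)\<^sup>2) \<partial>lborel) + ennreal b * (\<integral>\<^sup>+x. ennreal (gauss R x) \<partial>(lborel :: 'a measure))"
    by (simp add: nn_integral_add nn_integral_cmult)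
  also have "\<dots> \<le> ennreal a * ennreal (energy_const DIM('a) / R) + ennreal b * ennreal ((sqrt (2 * pi) * R) ^ DIM('a))"
    using packet_energy[OF R, where 'a='a] R by (intro add_mono mult_left_mono) (auto simp: energy_const_def nn_integral_gauss)
  also have "\<dots> = ennreal (a * (energy_const DIM('a) / R) + b * ((sqrt (2 * pi) * R) ^ DIM('a)))"
    using ab R energy_const_nonneg[of "DIM('a)"] by (simp flip: ennreal_mult ennreal_plus)
  also have "a * (energy_const DIM('a) / R) = energy_const DIM('a) * (a / R powr 1)"
    using R by simp
  also have "a / R powr 1 = R powr (?n - p * (?n + 1) / 2)"
    unfolding a_def powr_diff[symmetric] by (simp add: field_simps)
  also have "b * ((sqrt (2 * pi) * R) ^ DIM('a)) = sqrt (2 * pi) ^ DIM('a) * (b * R powr ?n)"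
    using R by (simp add: power_mult_distrib powr_realpow)
  also have "b * R powr ?n = R powr (?n - p * (?n + 1) / 2)"
    unfolding b_def powr_add[symmetric] by (simp add: field_simps)
  finally show ?thesis by (simp add: distrib_right)
qed

section \<open>Sums of packets at the critical exponent\<close>

lemma geometric_block_le:
  fixes a :: "nat \<Rightarrow> real"
  assumes "\<And>i. a i \<le> (1/2) ^ i"
  shows "(\<Sum>i=j..<j+m. a i) \<le> 2 * (1/2) ^ j"
proof (induction m arbitrary: j)
  case (Suc m)
  have "(\<Sum>i=j..<j+Suc m. a i) = a j + (\<Sum>i=Suc j..<Suc j + m. a i)"
    by (subst sum.atLeast_Suc_lessThan) auto
  also have "\<dots> \<le> (1/2) ^ j + 2 * (1/2) ^ Suc j"
    by (intro add_mono assms Suc.IH)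
  finally show ?case by simp
qed simp

text \<open>The \<open>n\<close>-th power of a sum that is dominated by a geometric series is controlled by its diagonal terms:
  telescoping over the tails \<open>T\<^sub>j\<close> of the sum, \<open>T\<^sub>j\<^sup>n - T\<^bsub>j+1\<^esub>\<^sup>n \<le> n a\<^sub>j T\<^sub>j\<^bsup>n-1\<^esup>\<close>, where \<open>T\<^sub>j\<close>
  is at most twice the bound for \<open>a\<^sub>j\<close>.\<close>

lemma power_sum_block_le:
  fixes a :: "nat \<Rightarrow> real"
  assumes a: "\<And>i. 0 \<le> a i" "\<And>i. a i \<le> (1/2) ^ i" and n: "n \<ge> 1"
  shows "(\<Sum>i=j..<j+m. a i) ^ n \<le> (\<Sum>i=j..<j+m. real n * a i * (2 * (1/2) ^ i) ^ (n - 1))"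
proof (induction m arbitrary: j)
  case 0
  then show ?case using n by (simp add: power_0_left)
next
  case (Suc m)
  let ?S = "\<Sum>i=j..<j+Suc m. a i" and ?T = "\<Sum>i=Suc j..<Suc j + m. a i"
  have S: "?S = a j + ?T" by (subst sum.atLeast_Suc_lessThan) auto
  have T: "0 \<le> ?T" by (intro sum_nonneg a)
  have "?S ^ n \<le> ?T ^ n + real n * (?S - ?T) * ?S ^ (n - 1)"
    using power_diff_le[of ?T ?S n] T a(1)[of j] S by simp
  also have "\<dots> \<le> ?T ^ n + real n * a j * (2 * (1/2) ^ j) ^ (n - 1)"
  proof -
    have "?S ^ (n - 1) \<le> (2 * (1/2) ^ j) ^ (n - 1)"
      using geometric_block_le[OF a(2), of j "Suc m"] S T a(1)[of j] by (intro power_mono) auto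
    then have "real n * a j * ?S ^ (n - 1) \<le> real n * a j * (2 * (1/2) ^ j) ^ (n - 1)"
      using a(1)[of j] by (intro mult_left_mono) auto
    then show ?thesis using S by simp
  qed
  also have "\<dots> \<le> (\<Sum>i=Suc j..<Suc j + m. real n * a i * (2 * (1/2) ^ i) ^ (n - 1)) + real n * a j * (2 * (1/2) ^ j) ^ (n - 1)"
    using Suc.IH[of "Suc j"] by simp
  also have "\<dots> = (\<Sum>i=j..<j+Suc m. real n * a i * (2 * (1/2) ^ i) ^ (n - 1))"
    by (subst (2) sum.atLeast_Suc_lessThan) auto
  finally show ?case .
qed

definition burst :: "nat \<Rightarrow> 'a::euclidean_space \<Rightarrow> complex" where
  "burst J x = (\<Sum>j=1..<1+J. packet (2 ^ j) x)"

lemma schwartz_burst: "schwartz (burst J)"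
  unfolding burst_def[abs_def] by (intro schwartz_sum schwartz_packet) simp

lemma burst_orthogonal:
  fixes A :: "'a::euclidean_space \<Rightarrow> 'a"
  assumes "orthogonal_transformation A" shows "burst J (A x) = burst J x"
  by (simp add: burst_def packet_orthogonal[OF assms])

lemma integrable_burst: "integrable lborel (burst J)"
  unfolding burst_def[abs_def] by (intro Bochner_Integration.integrable_sum integrable_packet) simp

text \<open>Let \<open>g\<^sub>j\<close> be the Gaussian of the \<open>j\<close>-th packet and \<open>t\<^sub>j\<close> the absolute value of the transform of the
  \<open>j\<close>-th shell. By Cauchy-Schwarz \<open>|F|\<^sup>2 \<le> V W\<close>, where \<open>V = \<Sum> 2\<^bsup>-j\<^esup> g\<^sub>j\<close> and
  \<open>W = \<Sum> 2\<^sup>j g\<^sub>j t\<^sub>j\<^sup>2\<close>. The energy bound makes every term of \<open>W\<close> contribute \<open>O(1)\<close>, and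
  \<open>power_sum_block_le\<close> does the same for \<open>V\<^sup>n\<close>, because the integral of \<open>2\<^bsup>-jn\<^esup> g\<^sub>j\<close> does
  not depend on \<open>j\<close>. The critical \<open>p\<close> is the exponent for which \<open>|F|\<^sup>p\<close> is bounded by a
  geometric mean of \<open>W\<close> and \<open>V\<^sup>n\<close>.\<close>

lemma burst_Lp_critical:
  assumes p: "p = 2 * real DIM('a) / (real DIM('a) + 1)"
  shows "(\<integral>\<^sup>+x. ennreal (norm (burst J x) powr p) \<partial>(lborel :: 'a::euclidean_space measure))
     \<le> ennreal ((energy_const DIM('a) + real DIM('a) * 2 ^ (DIM('a) - 1) * sqrt (2 * pi) ^ DIM('a)) * real J)"
proof -
  let ?n = "DIM('a)"
  let ?t = "\<lambda>j x::'a. norm (fourier (indicator (shell (2 ^ j))) x)" and ?g = "\<lambda>j x::'a. gauss (2 ^ j) x"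
  define I where "I = {1..<1+J}"
  have I: "finite I" "card I = J" by (simp_all add: I_def)
  define \<theta> where "\<theta> = real ?n / (real ?n + 1)"
  define V where "V x = (\<Sum>j\<in>I. (1/2) ^ j * ?g j x)" for x
  define W where "W x = (\<Sum>j\<in>I. 2 ^ j * (?g j x * (?t j x)\<^sup>2))" for x
  have n: "?n \<ge> 1" by (simp add: Suc_leI)
  have VW: "0 \<le> V x" "0 \<le> W x" for x unfolding V_def W_def by (rule sum_nonneg, simp)+
  have sq: "(norm (burst J x))\<^sup>2 \<le> V x * W x" for x
  proof -
    have "norm (burst J x) \<le> (\<Sum>j\<in>I. ?g j x * ?t j x)"
      unfolding burst_def I_def[symmetric] using norm_sum[of "\<lambda>j. packet (2 ^ j) x" I] by (simp add: norm_packet)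
    also have "\<dots> = (\<Sum>j\<in>I. sqrt ((1/2) ^ j * ?g j x) * sqrt (2 ^ j * (?g j x * (?t j x)\<^sup>2)))"
      by (intro sum.cong refl) (simp flip: real_sqrt_mult add: power_one_over power2_eq_square, simp add: real_sqrt_mult)
    finally have "(norm (burst J x))\<^sup>2 \<le> (\<Sum>j\<in>I. sqrt ((1/2) ^ j * ?g j x) * sqrt (2 ^ j * (?g j x * (?t j x)\<^sup>2)))\<^sup>2"
      by (intro power_mono) auto
    also have "\<dots> \<le> (\<Sum>j\<in>I. (sqrt ((1/2) ^ j * ?g j x))\<^sup>2) * (\<Sum>j\<in>I. (sqrt (2 ^ j * (?g j x * (?t j x)\<^sup>2)))\<^sup>2)"
      by (rule Cauchy_Schwarz_ineq_sum)
    also have "\<dots> = V x * W x" by (simp add: V_def W_def)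
    finally show ?thesis .
  qed
  have pw: "norm (burst J x) powr p \<le> W x + V x ^ ?n" for x
  proof -
    have "norm (burst J x) powr p = ((norm (burst J x)) powr 2) powr \<theta>"
      unfolding powr_powr by (simp add: p \<theta>_def)
    also have "\<dots> \<le> (V x * W x) powr \<theta>"
      using sq[of x] by (intro powr_mono2) (auto simp: \<theta>_def)
    also have "\<dots> = W x powr \<theta> * V x powr \<theta>" using VW by (simp add: powr_mult)
    also have "V x powr \<theta> = (V x powr real ?n) powr (1 - \<theta>)"
      unfolding powr_powr by (simp add: \<theta>_def field_simps)
    also have "V x powr real ?n = V x ^ ?n" using VW(1)[of x] n by (cases "V x = 0") (auto simp: powr_realpow)
    also have "W x powr \<theta> * (V x ^ ?n) powr (1 - \<theta>) \<le> W x + V x ^ ?n"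
      using VW by (intro weighted_geometric_mean_le_add) (auto simp: \<theta>_def)
    finally show ?thesis .
  qed
  have Vn: "V x ^ ?n \<le> (\<Sum>j\<in>I. (real ?n * 2 ^ (?n - 1) * (1/2) ^ (j * ?n)) * ?g j x)" for x
  proof -
    have "V x ^ ?n \<le> (\<Sum>j\<in>I. real ?n * ((1/2) ^ j * ?g j x) * (2 * (1/2) ^ j) ^ (?n - 1))"
      unfolding V_def I_def using n by (intro power_sum_block_le) (auto intro: mult_left_le gauss_le_1)
    also have "\<dots> = (\<Sum>j\<in>I. (real ?n * 2 ^ (?n - 1) * (1/2) ^ (j * ?n)) * ?g j x)"
    proof (intro sum.cong refl)
      fix j
      have "(1/2 :: real) ^ (j * ?n) = (1/2) ^ j * ((1/2) ^ j) ^ (?n - 1)"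
        using n by (cases ?n) (auto simp: power_mult[symmetric] power_add[symmetric])
      then show "real ?n * ((1/2) ^ j * ?g j x) * (2 * (1/2) ^ j) ^ (?n - 1) = (real ?n * 2 ^ (?n - 1) * (1/2) ^ (j * ?n)) * ?g j x"
        by (simp add: power_mult_distrib)
    qed
    finally show ?thesis .
  qed
  have "(\<integral>\<^sup>+x. ennreal (norm (burst J x) powr p) \<partial>(lborel :: 'a measure))
     \<le> (\<integral>\<^sup>+x. (\<Sum>j\<in>I. ennreal (2 ^ j) * ennreal (?g j x * (?t j x)\<^sup>2)) +
           (\<Sum>j\<in>I. ennreal (real ?n * 2 ^ (?n - 1) * (1/2) ^ (j * ?n)) * ennreal (?g j x)) \<partial>lborel)"
  proof (intro nn_integral_mono)
    fix x :: 'a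
    have "ennreal (norm (burst J x) powr p) \<le> ennreal (W x + (\<Sum>j\<in>I. (real ?n * 2 ^ (?n - 1) * (1/2) ^ (j * ?n)) * ?g j x))"
      using pw[of x] Vn[of x] by (intro ennreal_leI) auto
    also have "\<dots> = (\<Sum>j\<in>I. ennreal (2 ^ j) * ennreal (?g j x * (?t j x)\<^sup>2)) +
           (\<Sum>j\<in>I. ennreal (real ?n * 2 ^ (?n - 1) * (1/2) ^ (j * ?n)) * ennreal (?g j x))"
    proof -
      have "ennreal (W x) = (\<Sum>j\<in>I. ennreal (2 ^ j) * ennreal (?g j x * (?t j x)\<^sup>2))"
        unfolding W_def by (subst sum_ennreal[symmetric]) (simp_all add: ennreal_mult)
      moreover have "ennreal (\<Sum>j\<in>I. (real ?n * 2 ^ (?n - 1) * (1/2) ^ (j * ?n)) * ?g j x) =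
          (\<Sum>j\<in>I. ennreal (real ?n * 2 ^ (?n - 1) * (1/2) ^ (j * ?n)) * ennreal (?g j x))"
        by (subst sum_ennreal[symmetric]) (simp_all add: ennreal_mult)
      ultimately show ?thesis
        using VW(2)[of x] by (subst ennreal_plus) (auto intro!: sum_nonneg)
    qed
    finally show "ennreal (norm (burst J x) powr p) \<le> \<dots>" .
  qed
  also have "\<dots> = (\<Sum>j\<in>I. ennreal (2 ^ j) * (\<integral>\<^sup>+x. ennreal (?g j x * (?t j x)\<^sup>2) \<partial>lborel)) +
           (\<Sum>j\<in>I. ennreal (real ?n * 2 ^ (?n - 1) * (1/2) ^ (j * ?n)) * (\<integral>\<^sup>+x. ennreal (?g j x) \<partial>lborel))"
    by (simp add: nn_integral_add nn_integral_sum nn_integral_cmult)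
  also have "\<dots> \<le> (\<Sum>j\<in>I. ennreal (energy_const ?n)) + (\<Sum>j\<in>I. ennreal (real ?n * 2 ^ (?n - 1) * sqrt (2 * pi) ^ ?n))"
  proof (intro add_mono sum_mono)
    fix j
    have "ennreal (2 ^ j) * (\<integral>\<^sup>+x. ennreal (?g j x * (?t j x)\<^sup>2) \<partial>lborel) \<le> ennreal (2 ^ j) * ennreal (energy_const ?n / 2 ^ j)"
      using packet_energy[of "2 ^ j", where 'a='a] by (intro mult_left_mono) (auto simp: energy_const_def)
    also have "\<dots> = ennreal (energy_const ?n)"
      using energy_const_nonneg[of ?n] by (simp flip: ennreal_mult)
    finally show "ennreal (2 ^ j) * (\<integral>\<^sup>+x. ennreal (?g j x * (?t j x)\<^sup>2) \<partial>lborel) \<le> ennreal (energy_const ?n)" .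
    have "(1/2 :: real) ^ (j * ?n) * (sqrt (2 * pi) * 2 ^ j) ^ ?n = sqrt (2 * pi) ^ ?n"
      by (simp add: power_mult_distrib power_mult power_one_over)
    then show "ennreal (real ?n * 2 ^ (?n - 1) * (1/2) ^ (j * ?n)) * (\<integral>\<^sup>+x. ennreal (?g j x) \<partial>lborel)
       \<le> ennreal (real ?n * 2 ^ (?n - 1) * sqrt (2 * pi) ^ ?n)"
      by (simp add: nn_integral_gauss mult.assoc flip: ennreal_mult)
  qed
  also have "\<dots> = ennreal ((energy_const ?n + real ?n * 2 ^ (?n - 1) * sqrt (2 * pi) ^ ?n) * real J)"
  proof -
    have "of_nat J * ennreal x = ennreal (x * real J)" if "x \<ge> 0" for x
      using that by (simp add: mult.commute ennreal_mult flip: ennreal_of_nat_eq_real_of_nat)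
    then show ?thesis
      using energy_const_nonneg[of ?n] I by (simp add: distrib_right ennreal_plus[symmetric] del: ennreal_plus)
  qed
  finally show ?thesis .
qed

lemma fourier_burst_ge:
  fixes \<xi> :: "'a::euclidean_space"
  assumes \<xi>: "\<bar>norm \<xi> - 1\<bar> \<le> 1 / 2 ^ J"
  shows "real J * packet_const DIM('a) \<le> norm (fourier (burst J) \<xi>)"
proof -
  have "fourier (burst J) \<xi> = (\<Sum>j=1..<1+J. fourier (packet (2 ^ j)) \<xi>)"
    unfolding fourier_def burst_def sum_distrib_right
    by (intro Bochner_Integration.integral_sum fourier_integrable integrable_packet) simp
  also have "\<dots> = complex_of_real (\<Sum>j=1..<1+J. packet_hat (2 ^ j) \<xi>)"
    by (simp add: fourier_packet)
  finally have "norm (fourier (burst J) \<xi>) \<ge> (\<Sum>j=1..<1+J. packet_hat (2 ^ j) \<xi>)"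
    by simp
  moreover have "(\<Sum>j=1..<1+J. packet_hat (2 ^ j) \<xi>) \<ge> (\<Sum>j=1..<1+J. packet_const DIM('a))"
  proof (intro sum_mono packet_hat_ge)
    fix j assume j: "j \<in> {1..<1+J}"
    then show "(2::real) ^ j > 1" by simp
    have "(2::real) ^ j \<le> 2 ^ J" using j by (intro power_increasing) auto
    then have "1 / (2::real) ^ J \<le> 1 / 2 ^ j" by (simp add: frac_le)
    then show "\<bar>norm \<xi> - 1\<bar> \<le> 1 / 2 ^ j" using \<xi> by simp
  qed
  ultimately show ?thesis by simp
qed

section \<open>Lebesgue norms, caps of the sphere, and product functions\<close>

lemma Lp_norm_le:
  assumes p: "1 \<le> r" and I: "I \<ge> 0" "(\<integral>\<^sup>+x. ennreal (norm (f x) powr r) \<partial>M) \<le> ennreal I"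
  shows "Lp_norm M (ereal r) f \<le> ennreal (I powr (1 / r))"
proof -
  let ?I = "\<integral>\<^sup>+x. ennreal (norm (f x) powr r) \<partial>M"
  have "?I \<noteq> \<infinity>" using I(2) by (auto simp: top_unique)
  moreover have "enn2real ?I \<le> I" using I by (metis enn2real_ennreal enn2real_mono ennreal_less_top)
  ultimately show ?thesis
    using p by (auto simp: Lp_norm_def Let_def intro!: ennreal_leI powr_mono2)
qed

lemma Lp_norm_inf_le:
  assumes "f \<in> borel_measurable M" "\<And>x. norm (f x) \<le> B"
  shows "Lp_norm M \<infinity> f \<le> ennreal B"
proof -
  note assms(1)[measurable]
  show ?thesis
    using assms(2) by (auto simp: Lp_norm_def intro!: esssup_I ennreal_leI)
qed

text \<open>Chebyshev's inequality. Taking \<open>real_of_ereal (1 / q)\<close> as the exponent covers \<open>q = \<infinity>\<close>, where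
  it is \<open>0\<close>.\<close>

lemma Lp_norm_ge:
  assumes q: "1 \<le> q" and A: "A \<in> sets M" and \<kappa>: "\<kappa> > 0" "ennreal \<kappa> \<le> emeasure M A"
    and L: "L \<ge> 0" "\<And>x. x \<in> A \<Longrightarrow> L \<le> norm (f x)"
  shows "ennreal (L * \<kappa> powr real_of_ereal (1 / q)) \<le> Lp_norm M q f"
proof (cases "q = \<infinity>")
  case True
  let ?f = "\<lambda>x. ennreal (norm (f x))"
  have "ennreal L \<le> esssup M ?f"
  proof (cases "?f \<in> borel_measurable M")
    case True
    show ?thesis
    proof (rule ccontr)
      assume "\<not> ?thesis"
      then have "AE x in M. \<not> ennreal L \<le> ?f x"
        using esssup_AE[of ?f M] by (elim eventually_mono) (metis order_trans)
      then have "AE x in M. x \<notin> A"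
        by eventually_elim (use L(2) in \<open>auto intro: ennreal_leI\<close>)
      then have "emeasure M A = 0"
        using A by (subst (asm) AE_iff_measurable[of A]) (auto dest: sets.sets_into_space)
      with \<kappa> show False by (simp add: ennreal_eq_0_iff)
    qed
  qed (simp add: esssup_non_measurable)
  then show ?thesis using True \<kappa> by (simp add: Lp_norm_def)
next
  case False
  with q obtain r where r: "q = ereal r" "r \<ge> 1"
    by (cases q) (auto simp: one_ereal_def)
  let ?I = "\<integral>\<^sup>+x. ennreal (norm (f x) powr r) \<partial>M"
  show ?thesis
  proof (cases "?I = \<infinity>")
    case True
    then show ?thesis using r by (simp add: Lp_norm_def)
  next
    case fin: False
    have "ennreal (L powr r * \<kappa>) \<le> ennreal (L powr r) * emeasure M A"
      using \<kappa> L by (auto simp: ennreal_mult intro: mult_left_mono)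
    also have "\<dots> = (\<integral>\<^sup>+x. ennreal (L powr r) * indicator A x \<partial>M)"
      using A by (simp add: nn_integral_cmult_indicator)
    also have "\<dots> \<le> ?I"
      using L r by (intro nn_integral_mono) (auto simp: indicator_def intro!: ennreal_leI powr_mono2)
    finally have "L powr r * \<kappa> \<le> enn2real ?I"
      using fin L \<kappa> by (metis enn2real_ennreal enn2real_mono infinity_ennreal_def less_top mult_nonneg_nonneg powr_ge_zero less_imp_le)
    then have "(L powr r * \<kappa>) powr (1 / r) \<le> enn2real ?I powr (1 / r)"
      using r \<kappa> by (intro powr_mono2) auto
    moreover have "(L powr r * \<kappa>) powr (1 / r) = L * \<kappa> powr (1 / r)"
      using L \<kappa> r by (simp add: powr_mult powr_powr)
    moreover have "real_of_ereal (1 / q) = 1 / r"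
      using r by (simp add: one_ereal_def)
    ultimately show ?thesis
      using fin r by (simp add: Lp_norm_def Let_def ennreal_leI)
  qed
qed

lemma emeasure_sphere_measure_ge:
  fixes A B :: "'a::euclidean_space set"
  assumes A: "A \<in> sets borel" "A \<subseteq> sphere 0 1" and B: "\<And>x. x \<in> B \<Longrightarrow> 0 < norm x \<and> norm x < 1 \<and> sgn x \<in> A"
  shows "emeasure lborel B \<le> emeasure sphere_measure A"
proof -
  let ?C = "{r *\<^sub>R u |r u. 0 < r \<and> r < 1 \<and> u \<in> A}"
  have C: "?C = {x. norm x \<in> {0<..<1} \<and> sgn x \<in> A}"
  proof (intro equalityI subsetI)
    fix x assume "x \<in> ?C"
    then obtain r u where x: "x = r *\<^sub>R u" "0 < r" "r < 1" "u \<in> A" by blast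
    moreover from this A have "norm u = 1" "u \<noteq> 0" by auto
    ultimately show "x \<in> {x. norm x \<in> {0<..<1} \<and> sgn x \<in> A}" by (simp add: sgn_div_norm)
  next
    fix x assume "x \<in> {x. norm x \<in> {0<..<1} \<and> sgn x \<in> A}"
    then show "x \<in> ?C"
      by (intro CollectI exI[of _ "norm x"] exI[of _ "sgn x"]) (auto simp: sgn_div_norm)
  qed
  have "{x::'a. norm x \<in> {0<..<1} \<and> sgn x \<in> A} \<in> sets borel"
    using A(1) by measurable
  then have "emeasure lborel B \<le> emeasure lborel ?C"
    unfolding C using B by (intro emeasure_mono) auto
  also have "\<dots> = 1 * emeasure lborel ?C" by simp
  also have "\<dots> \<le> of_nat DIM('a) * emeasure lborel ?C"
  proof (rule mult_right_mono)
    have "(of_nat 1 :: ennreal) \<le> of_nat DIM('a)"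
      by (rule of_nat_mono) (simp add: Suc_leI)
    then show "(1 :: ennreal) \<le> of_nat DIM('a)" by simp
  qed simp
  finally show ?thesis using emeasure_sphere_measure[OF A] by simp
qed

lemma sets_sphere_measure: "A \<in> sets borel \<Longrightarrow> A \<subseteq> sphere 0 1 \<Longrightarrow> A \<in> sets sphere_measure"
  by (simp add: sphere_measure_def sets_restrict_space_iff)

lemma emeasure_sphere_ge:
  "ennreal (unit_ball_vol DIM('a)) \<le> emeasure sphere_measure (sphere (0::'a::euclidean_space) 1)"
proof -
  have "ennreal (unit_ball_vol DIM('a)) = emeasure lborel (ball (0::'a) 1)"
    by (simp add: emeasure_ball)
  also have "\<dots> = emeasure lborel (ball (0::'a) 1 - {0})"
    by (rule emeasure_Diff_null_set[symmetric]) auto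
  also have "\<dots> \<le> emeasure sphere_measure (sphere (0::'a) 1)"
    by (rule emeasure_sphere_measure_ge) (auto simp: norm_sgn)
  finally show ?thesis .
qed

lemma emeasure_lborel_ball_times_ball:
  fixes c :: "'a::euclidean_space" and e :: "'b::euclidean_space"
  assumes "r \<ge> 0" "s \<ge> 0"
  shows "emeasure lborel (ball c r \<times> ball e s) = ennreal (unit_ball_vol DIM('a) * r ^ DIM('a) * (unit_ball_vol DIM('b) * s ^ DIM('b)))"
  using assms
  by (subst lborel_prod[symmetric], subst lborel.emeasure_pair_measure_Times)
     (auto simp: emeasure_ball simp flip: ennreal_mult)

text \<open>Times \<open>\<delta>\<^sup>n\<close>, this is the volume of a product of balls of radii \<open>1/4\<close> and \<open>\<delta>/4\<close>. Such a
  product lies in the cone over a cap of width \<open>\<delta>\<close>.\<close>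

definition cap_const :: "nat \<Rightarrow> nat \<Rightarrow> real" where
  "cap_const m n = unit_ball_vol (real m) * unit_ball_vol (real n) / 4 ^ (m + n)"

lemma cap_const_pos: "cap_const m n > 0"
  by (simp add: cap_const_def)

text \<open>Here \<open>x\<close> and \<open>y\<close> stand for the norms of the two components of a point and \<open>z\<close> for the norm of
  the point itself: such a point lies in the open unit ball, and its projection to the sphere lies in the
  cap of width \<open>\<delta>\<close>.\<close>

lemma cap_cone_bounds:
  fixes x y :: real
  assumes x: "1/4 < x" "x < 3/4" and y: "0 \<le> y" "y < \<delta> / 4" and \<delta>: "\<delta> \<le> 1" and z: "x \<le> z" "z \<le> x + y"
  shows "0 < z" "z < 1" "y / z \<le> \<delta>"
proof -
  show "0 < z" "z < 1" using assms by auto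
  have "\<delta> * (1/4) \<le> \<delta> * z"
    using assms by (intro mult_left_mono) auto
  then have "y \<le> \<delta> * z" using y by linarith
  then show "y / z \<le> \<delta>" using \<open>0 < z\<close> by (simp add: pos_divide_le_eq)
qed

lemma norm_near_half:
  fixes e u :: "'a::euclidean_space"
  assumes "norm e = 1" "u \<in> ball (e /\<^sub>R 2) (1/4)"
  shows "1/4 < norm u" "norm u < 3/4"
  using norm_triangle_ineq3[of "e /\<^sub>R 2" u] assms by (auto simp: dist_norm)

lemma emeasure_snd_cap_ge:
  assumes \<delta>: "0 < \<delta>" "\<delta> \<le> 1"
  shows "ennreal (cap_const DIM('a) DIM('b) * \<delta> ^ DIM('b))
     \<le> emeasure sphere_measure {z :: 'a::euclidean_space \<times> 'b::euclidean_space. norm z = 1 \<and> norm (snd z) \<le> \<delta>}"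
proof -
  obtain e :: 'a where e: "norm e = 1" using vector_choose_size[of 1] by auto
  have "ennreal (cap_const DIM('a) DIM('b) * \<delta> ^ DIM('b)) = emeasure lborel (ball (e /\<^sub>R 2) (1/4) \<times> ball (0::'b) (\<delta>/4))"
    using \<delta> by (subst emeasure_lborel_ball_times_ball) (auto simp: cap_const_def power_divide power_add)
  also have "\<dots> \<le> emeasure sphere_measure {z :: 'a \<times> 'b. norm z = 1 \<and> norm (snd z) \<le> \<delta>}"
  proof (rule emeasure_sphere_measure_ge)
    fix z :: "'a \<times> 'b" assume z: "z \<in> ball (e /\<^sub>R 2) (1/4) \<times> ball 0 (\<delta>/4)"
    then have fz: "fst z \<in> ball (e /\<^sub>R 2) (1/4)" and sz: "norm (snd z) < \<delta> / 4" by auto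
    have "norm (fst z) \<le> norm z" "norm z \<le> norm (fst z) + norm (snd z)"
      using norm_fst_le[of "fst z" "snd z"] norm_Pair_le[of "fst z" "snd z"] by auto
    note * = cap_cone_bounds[OF norm_near_half[OF e fz] norm_ge_zero sz \<delta>(2) this]
    then show "0 < norm z \<and> norm z < 1 \<and> sgn z \<in> {z. norm z = 1 \<and> norm (snd z) \<le> \<delta>}"
      by (auto simp: norm_sgn sgn_div_norm divide_inverse mult.commute)
  qed (auto intro!: borel_closed closed_Collect_conj closed_Collect_eq closed_Collect_le continuous_intros)
  finally show ?thesis .
qed

lemma emeasure_fst_cap_ge:
  assumes \<delta>: "0 < \<delta>" "\<delta> \<le> 1"
  shows "ennreal (cap_const DIM('a) DIM('b) * \<delta> ^ DIM('a))
     \<le> emeasure sphere_measure {z :: 'a::euclidean_space \<times> 'b::euclidean_space. norm z = 1 \<and> norm (fst z) \<le> \<delta>}"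
proof -
  obtain e :: 'b where e: "norm e = 1" using vector_choose_size[of 1] by auto
  have "ennreal (cap_const DIM('a) DIM('b) * \<delta> ^ DIM('a)) = emeasure lborel (ball (0::'a) (\<delta>/4) \<times> ball (e /\<^sub>R 2) (1/4))"
    using \<delta> by (subst emeasure_lborel_ball_times_ball) (auto simp: cap_const_def power_divide power_add)
  also have "\<dots> \<le> emeasure sphere_measure {z :: 'a \<times> 'b. norm z = 1 \<and> norm (fst z) \<le> \<delta>}"
  proof (rule emeasure_sphere_measure_ge)
    fix z :: "'a \<times> 'b" assume z: "z \<in> ball 0 (\<delta>/4) \<times> ball (e /\<^sub>R 2) (1/4)"
    then have sz: "snd z \<in> ball (e /\<^sub>R 2) (1/4)" and fz: "norm (fst z) < \<delta> / 4" by auto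
    have "norm (snd z) \<le> norm z" "norm z \<le> norm (snd z) + norm (fst z)"
      using norm_snd_le[of "snd z" "fst z"] norm_Pair_le[of "fst z" "snd z"] by auto
    note * = cap_cone_bounds[OF norm_near_half[OF e sz] norm_ge_zero fz \<delta>(2) this]
    then show "0 < norm z \<and> norm z < 1 \<and> sgn z \<in> {z. norm z = 1 \<and> norm (fst z) \<le> \<delta>}"
      by (auto simp: norm_sgn sgn_div_norm divide_inverse mult.commute)
  qed (auto intro!: borel_closed closed_Collect_conj closed_Collect_eq closed_Collect_le continuous_intros)
  finally show ?thesis .
qed

lemma fourier_tensor:
  fixes f :: "'a::euclidean_space \<Rightarrow> complex" and g :: "'b::euclidean_space \<Rightarrow> complex"
  assumes f: "integrable lborel f" and g: "integrable lborel g"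
  shows "fourier (\<lambda>z. f (fst z) * g (snd z)) \<zeta> = fourier f (fst \<zeta>) * fourier g (snd \<zeta>)"
proof -
  let ?f = "\<lambda>x. f x * exp (- \<i> * complex_of_real (fst \<zeta> \<bullet> x))"
    and ?g = "\<lambda>y. g y * exp (- \<i> * complex_of_real (snd \<zeta> \<bullet> y))"
  have i: "integrable lborel ?f" "integrable lborel ?g"
    using f g by (intro fourier_integrable; simp)+
  have [measurable]: "f \<in> borel_measurable borel" "g \<in> borel_measurable borel"
    using f g by (auto dest: borel_measurable_integrable)
  have int: "integrable (lborel \<Otimes>\<^sub>M lborel) (\<lambda>(x, y). ?f x * ?g y)"
  proof (rule lborel_pair.Fubini_integrable)
    show "(\<lambda>(x, y). ?f x * ?g y) \<in> borel_measurable (lborel \<Otimes>\<^sub>M lborel)" by measurable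
    show "integrable lborel (\<lambda>x. \<integral>y. norm (case (x, y) of (x, y) \<Rightarrow> ?f x * ?g y) \<partial>lborel)"
      using f g by (simp add: norm_mult)
    show "AE x in lborel. integrable lborel (\<lambda>y. case (x, y) of (x, y) \<Rightarrow> ?f x * ?g y)"
      using i(2) by simp
  qed
  have "fourier (\<lambda>z. f (fst z) * g (snd z)) \<zeta> = (\<integral>z. (case z of (x, y) \<Rightarrow> ?f x * ?g y) \<partial>(lborel \<Otimes>\<^sub>M lborel))"
    unfolding fourier_def lborel_prod
    by (intro Bochner_Integration.integral_cong refl)
       (auto simp: inner_prod_def ring_distribs exp_add exp_diff exp_minus field_simps split: prod.splits)
  also have "\<dots> = (\<integral>x. (\<integral>y. ?f x * ?g y \<partial>lborel) \<partial>lborel)"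
    using lborel_pair.integral_fst'[OF int] by simp
  also have "\<dots> = fourier f (fst \<zeta>) * fourier g (snd \<zeta>)"
    by (simp add: fourier_def)
  finally show ?thesis .
qed

lemma nn_integral_tensor:
  fixes f :: "'a::euclidean_space \<Rightarrow> complex" and g :: "'b::euclidean_space \<Rightarrow> complex"
  assumes [measurable]: "f \<in> borel_measurable borel" "g \<in> borel_measurable borel"
  shows "(\<integral>\<^sup>+z. ennreal (norm (f (fst z) * g (snd z)) powr r) \<partial>lborel) =
     (\<integral>\<^sup>+x. ennreal (norm (f x) powr r) \<partial>lborel) * (\<integral>\<^sup>+y. ennreal (norm (g y) powr r) \<partial>lborel)"
proof -
  have "(\<integral>\<^sup>+z. ennreal (norm (f (fst z) * g (snd z)) powr r) \<partial>lborel) =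
     (\<integral>\<^sup>+z. ennreal (norm (f (fst z)) powr r) * ennreal (norm (g (snd z)) powr r) \<partial>(lborel \<Otimes>\<^sub>M lborel))"
    unfolding lborel_prod by (intro nn_integral_cong) (simp add: norm_mult powr_mult ennreal_mult)
  also have "\<dots> = (\<integral>\<^sup>+x. (\<integral>\<^sup>+y. ennreal (norm (f x) powr r) * ennreal (norm (g y) powr r) \<partial>lborel) \<partial>lborel)"
    by (subst lborel.nn_integral_fst[symmetric]) auto
  also have "\<dots> = (\<integral>\<^sup>+x. ennreal (norm (f x) powr r) \<partial>lborel) * (\<integral>\<^sup>+y. ennreal (norm (g y) powr r) \<partial>lborel)"
    by (simp add: nn_integral_cmult nn_integral_multc)
  finally show ?thesis .
qed

section \<open>Exponents forced by a bound for radial functions\<close>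

text \<open>What the restriction inequality implies for radial functions \<open>f\<close> on one block, after multiplication by a
  Gaussian of width \<open>1/\<delta>\<close> in the other block: \<open>L\<close> is a lower bound for the transform where the
  component of a point of the cap of width \<open>\<delta>\<close> in that block can lie, and \<open>t\<close> collects the powers of
  \<open>\<delta>\<close> from the measure of the cap and from the Gaussian. The case \<open>t = 0\<close> arises from
  radial functions on the whole space.\<close>

definition radial_bound :: "'c::euclidean_space itself \<Rightarrow> real \<Rightarrow> real \<Rightarrow> real \<Rightarrow> bool" where
  "radial_bound T r t K \<longleftrightarrow>
     (\<forall>\<delta> L I. \<forall>f :: 'c \<Rightarrow> complex.
        0 < \<delta> \<longrightarrow> \<delta> \<le> 1 \<longrightarrow> 0 \<le> L \<longrightarrow> 0 \<le> I \<longrightarrow>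
        schwartz f \<longrightarrow> integrable lborel f \<longrightarrow>
        (\<forall>A. orthogonal_transformation A \<longrightarrow> (\<forall>x. f (A x) = f x)) \<longrightarrow>
        (\<forall>\<xi>. \<bar>norm \<xi> - 1\<bar> \<le> \<delta>\<^sup>2 \<longrightarrow> L \<le> norm (fourier f \<xi>)) \<longrightarrow>
        (\<integral>\<^sup>+x. ennreal (norm (f x) powr r) \<partial>lborel) \<le> ennreal I \<longrightarrow>
        L * \<delta> powr t \<le> K * I powr (1 / r))"

lemma powr_bounded_imp_nonpos:
  fixes e B :: real
  assumes "\<And>R. R \<ge> R0 \<Longrightarrow> R powr e \<le> B"
  shows "e \<le> 0"
proof (rule ccontr)
  assume "\<not> e \<le> 0"
  then have e: "e > 0" by simp
  \<comment> \<open>At the second entry of the maximum the power exceeds \<open>B\<close>.\<close>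
  let ?R = "max R0 ((\<bar>B\<bar> + 1) powr (1 / e))"
  have "\<bar>B\<bar> + 1 = ((\<bar>B\<bar> + 1) powr (1 / e)) powr e" using e by (simp add: powr_powr)
  also have "\<dots> \<le> ?R powr e" using e by (intro powr_mono2) auto
  also have "\<dots> \<le> B" by (rule assms) simp
  finally show False by simp
qed

lemma fourier_packet_ge:
  fixes \<xi> :: "'a::euclidean_space"
  assumes "R > 1" "\<bar>norm \<xi> - 1\<bar> \<le> 1 / R"
  shows "packet_const DIM('a) \<le> norm (fourier (packet R) \<xi>)"
  using packet_hat_ge[OF assms] assms by (simp add: fourier_packet)

lemma radial_bound_packet:
  assumes rb: "radial_bound TYPE('c::euclidean_space) r t K"
    and R: "R \<ge> 2" and \<delta>: "0 < \<delta>" "\<delta>\<^sup>2 \<le> 1 / R" and I: "0 \<le> I"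
      "(\<integral>\<^sup>+x. ennreal (norm (packet R x) powr r) \<partial>(lborel :: 'c measure)) \<le> ennreal I"
  shows "packet_const DIM('c) * \<delta> powr t \<le> K * I powr (1 / r)"
proof -
  have "\<delta>\<^sup>2 \<le> 1\<^sup>2" using \<delta> R by (auto intro: order_trans)
  then have "\<delta> \<le> 1" using \<delta> by (simp add: power_le_one_iff abs_square_le_1)
  moreover have "packet_const DIM('c) \<le> norm (fourier (packet R) \<xi>)" if "\<bar>norm \<xi> - 1\<bar> \<le> \<delta>\<^sup>2" for \<xi> :: 'c
    using that R \<delta> by (intro fourier_packet_ge) auto
  ultimately show ?thesis
    using rb[unfolded radial_bound_def, rule_format, of \<delta> "packet_const DIM('c)" I "packet R"] R \<delta> I
      packet_const_pos[of "DIM('c)"]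
    by (simp add: schwartz_packet integrable_packet packet_orthogonal)
qed

text \<open>A fixed packet, with \<open>\<delta>\<close> tending to \<open>0\<close>.\<close>

lemma radial_bound_exponent_nonneg:
  assumes rb: "radial_bound TYPE('c::euclidean_space) r t K" and r: "1 \<le> r" "r \<le> 2"
  shows "t \<ge> 0"
proof -
  let ?c = "packet_const DIM('c)"
  define I where "I = (energy_const DIM('c) + sqrt (2 * pi) ^ DIM('c)) * 2 powr (real DIM('c) - r * (real DIM('c) + 1) / 2)"
  have I: "I \<ge> 0" by (auto simp: I_def energy_const_nonneg)
  have "R powr (- t) \<le> K * I powr (1 / r) / ?c" if R: "R \<ge> 2" for R
  proof -
    have "2 * 1 \<le> R * R" using R by (intro mult_mono) auto
    then have "(1 / R)\<^sup>2 \<le> 1 / 2" using R by (simp add: power_divide power2_eq_square field_simps)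
    then have "?c * (1 / R) powr t \<le> K * I powr (1 / r)"
      using R I packet_Lp_low[of 2 r, where 'a='c] r
      by (intro radial_bound_packet[OF rb, of 2]) (auto simp: I_def)
    then show ?thesis
      using R packet_const_pos[of "DIM('c)"] by (simp add: powr_minus powr_divide field_simps)
  qed
  then have "- t \<le> 0" by (rule powr_bounded_imp_nonpos)
  then show ?thesis by simp
qed

text \<open>The packet of scale \<open>R = \<delta>\<^bsup>-2\<^esup>\<close>, which is the largest for which the lower bound of the transform
  holds on the whole cap.\<close>

lemma radial_bound_exponent_ge:
  assumes rb: "radial_bound TYPE('c::euclidean_space) r t K" and r: "1 \<le> r" "r \<le> 2"
  shows "real DIM('c) + 1 \<le> t + 2 * real DIM('c) / r"
proof -
  let ?c = "packet_const DIM('c)" and ?n = "real DIM('c)"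
  define M where "M = energy_const DIM('c) + sqrt (2 * pi) ^ DIM('c)"
  have M: "M \<ge> 0" by (auto simp: M_def energy_const_nonneg)
  let ?e = "- t / 2 - (?n / r - (?n + 1) / 2)"
  have "R powr ?e \<le> K * M powr (1 / r) / ?c" if R: "R \<ge> 2" for R
  proof -
    let ?\<delta> = "R powr (- 1 / 2)"
    have "?\<delta>\<^sup>2 = ?\<delta> powr 2" by simp
    also have "\<dots> = 1 / R" using R by (simp only: powr_powr) (simp add: powr_minus_divide)
    finally have "?c * ?\<delta> powr t \<le> K * (M * R powr (?n - r * (?n + 1) / 2)) powr (1 / r)"
      using R M packet_Lp_low[of R r, where 'a='c] r
      by (intro radial_bound_packet[OF rb R]) (auto simp: M_def)
    also have "(M * R powr (?n - r * (?n + 1) / 2)) powr (1 / r) = M powr (1 / r) * R powr ((?n - r * (?n + 1) / 2) * (1 / r))"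
      using M by (simp add: powr_mult powr_powr)
    also have "(?n - r * (?n + 1) / 2) * (1 / r) = ?n / r - (?n + 1) / 2"
      using r by (simp add: field_simps)
    also have "?\<delta> powr t = R powr (- t / 2)" by (simp add: powr_powr)
    finally have "R powr (- t / 2) / R powr (?n / r - (?n + 1) / 2) \<le> K * M powr (1 / r) / ?c"
      using R packet_const_pos[of "DIM('c)"] by (simp add: field_simps)
    then show ?thesis by (simp only: powr_diff)
  qed
  then have "?e \<le> 0" by (rule powr_bounded_imp_nonpos)
  then show ?thesis by (simp add: field_simps)
qed

text \<open>The sum of \<open>J\<close> packets gains \<open>J\<close> on the left and loses only \<open>J\<^bsup>1/r\<^esup>\<close> on the right.\<close>

lemma radial_bound_critical:
  assumes rb: "radial_bound TYPE('c::euclidean_space) r 0 K" and n: "DIM('c) \<ge> 2"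
  shows "r \<noteq> 2 * real DIM('c) / (real DIM('c) + 1)"
proof
  assume r: "r = 2 * real DIM('c) / (real DIM('c) + 1)"
  have r1: "r > 1" using n by (simp add: r)
  let ?c = "packet_const DIM('c)" and ?n = "DIM('c)"
  define M where "M = energy_const ?n + real ?n * 2 ^ (?n - 1) * sqrt (2 * pi) ^ ?n"
  have M: "M \<ge> 0" by (auto simp: M_def energy_const_nonneg)
  have *: "real J powr (1 - 1 / r) \<le> K * M powr (1 / r) / ?c" if J: "J > 0" for J :: nat
  proof -
    \<comment> \<open>Then \<open>?\<delta>\<^sup>2 = 2\<^bsup>-J\<^esup>\<close> is the width of the thinnest of the \<open>J\<close> shells.\<close>
    let ?\<delta> = "sqrt (1 / 2 ^ J)"
    have "?\<delta> \<le> 1" by simp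
    moreover have "0 < ?\<delta>" by simp
    moreover have "real J * ?c \<le> norm (fourier (burst J) \<xi>)" if "\<bar>norm \<xi> - 1\<bar> \<le> ?\<delta>\<^sup>2" for \<xi> :: 'c
      using that by (intro fourier_burst_ge) auto
    ultimately have "(real J * ?c) * ?\<delta> powr 0 \<le> K * (M * real J) powr (1 / r)"
      using rb[unfolded radial_bound_def, rule_format, of ?\<delta> "real J * ?c" "M * real J" "burst J"]
        burst_Lp_critical[OF r, of J] M packet_const_pos[of ?n]
      by (simp add: schwartz_burst integrable_burst burst_orthogonal M_def)
    then have "real J * ?c \<le> K * (M powr (1 / r) * real J powr (1 / r))"
      using M by (simp add: powr_mult)
    then have "real J powr 1 / real J powr (1 / r) \<le> K * M powr (1 / r) / ?c"
      using J packet_const_pos[of ?n] by (simp add: field_simps)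
    then show ?thesis by (simp only: powr_diff)
  qed
  have "R powr (1 - 1 / r) \<le> K * M powr (1 / r) / ?c" if R: "R \<ge> 1" for R :: real
  proof -
    have "R powr (1 - 1 / r) \<le> real (nat \<lceil>R\<rceil>) powr (1 - 1 / r)"
      using R r1 by (intro powr_mono2) (auto simp: of_nat_ceiling)
    also have "\<dots> \<le> K * M powr (1 / r) / ?c" using R by (intro *) simp
    finally show ?thesis .
  qed
  then have "1 - 1 / r \<le> 0" by (rule powr_bounded_imp_nonpos)
  then show False using r1 by simp
qed

lemma radial_bound_exponents:
  assumes rb: "radial_bound TYPE('c::euclidean_space) r t K" and r: "1 \<le> r" "r \<le> 2" and n: "DIM('c) \<ge> 2"
  shows "0 \<le> t" "real DIM('c) + 1 \<le> t + 2 * real DIM('c) * (1 / r)"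
    "t = 0 \<Longrightarrow> 1 / r \<noteq> (real DIM('c) + 1) / (2 * real DIM('c))"
proof -
  show "0 \<le> t" using rb r by (rule radial_bound_exponent_nonneg)
  show "real DIM('c) + 1 \<le> t + 2 * real DIM('c) * (1 / r)"
    using radial_bound_exponent_ge[OF rb r] by simp
  assume "t = 0"
  then have "r \<noteq> 2 * real DIM('c) / (real DIM('c) + 1)"
    using radial_bound_critical rb n by blast
  then show "1 / r \<noteq> (real DIM('c) + 1) / (2 * real DIM('c))"
    using r n by (auto simp: field_simps)
qed

text \<open>For \<open>r \<ge> 2\<close> the norms of the packets tend to \<open>0\<close>, while their transforms do not.\<close>

lemma radial_bound_less_2:
  assumes rb: "radial_bound TYPE('c::euclidean_space) r 0 K"
  shows "r < 2"
proof (rule ccontr)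
  assume "\<not> r < 2"
  then have r: "r \<ge> 2" by simp
  let ?c = "packet_const DIM('c)" and ?E = "energy_const DIM('c)"
  have "R powr (1 / r) \<le> K * ?E powr (1 / r) / ?c" if R: "R \<ge> max 2 (shell_const DIM('c))" for R
  proof -
    have "?c * (1 / R) powr 0 \<le> K * (?E / R) powr (1 / r)"
    proof (rule radial_bound_packet[OF rb])
      have "R * 1 \<le> R * R" using R by (intro mult_left_mono) auto
      then show "(1 / R)\<^sup>2 \<le> 1 / R" using R by (simp add: power_divide power2_eq_square field_simps)
    qed (use R packet_Lp_high[of R r, where 'a='c] r energy_const_nonneg[of "DIM('c)"] in auto)
    then show ?thesis
      using R packet_const_pos[of "DIM('c)"] energy_const_nonneg[of "DIM('c)"] by (simp add: powr_divide field_simps)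
  qed
  then have "1 / r \<le> 0" by (rule powr_bounded_imp_nonpos)
  then show False using r by simp
qed

section \<open>Testing the restriction inequality\<close>

lemma near_one_of_square:
  fixes x :: real
  assumes "0 \<le> x" "x\<^sup>2 + y = 1" "0 \<le> y" "y \<le> e"
  shows "\<bar>x - 1\<bar> \<le> e"
proof -
  have "x\<^sup>2 \<le> 1" using assms by simp
  then have "x \<le> 1" using assms by (simp add: abs_square_le_1)
  then have "x * x \<le> x * 1" using assms by (intro mult_left_mono) auto
  then have "1 - x \<le> y" using assms by (simp add: power2_eq_square)
  then show ?thesis using \<open>x \<le> 1\<close> assms by simp
qed

locale block_restriction =
  fixes T :: "('a::euclidean_space \<times> 'b::euclidean_space) itself"
    and p q :: ereal and C :: ennreal
  assumes q: "1 \<le> q" and C: "C < \<infinity>"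
    and restriction: "\<And>f :: 'a \<times> 'b \<Rightarrow> complex. schwartz f \<Longrightarrow> block_symmetric f \<Longrightarrow>
       Lp_norm sphere_measure q (fourier f) \<le> C * Lp_norm lborel p f"
begin

definition qinv :: real where "qinv = real_of_ereal (1 / q)"

lemma restriction_on_subset:
  fixes f :: "'a \<times> 'b \<Rightarrow> complex"
  assumes f: "schwartz f" "block_symmetric f"
    and A: "A \<in> sets borel" "A \<subseteq> sphere 0 1" "0 < \<kappa>" "ennreal \<kappa> \<le> emeasure sphere_measure A"
    and L: "0 \<le> L" "\<And>\<xi>. \<xi> \<in> A \<Longrightarrow> L \<le> norm (fourier f \<xi>)"
    and N: "Lp_norm lborel p f \<le> ennreal N" "0 \<le> N"
  shows "L * \<kappa> powr qinv \<le> enn2real C * N"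
proof -
  have "ennreal (L * \<kappa> powr qinv) \<le> Lp_norm sphere_measure q (fourier f)"
    unfolding qinv_def using A L by (intro Lp_norm_ge[OF q sets_sphere_measure[OF A(1,2)]]) auto
  also have "\<dots> \<le> C * Lp_norm lborel p f" using f by (rule restriction)
  also have "\<dots> \<le> C * ennreal N" using N by (intro mult_left_mono) auto
  also have "\<dots> = ennreal (enn2real C * N)" using C N by (simp add: ennreal_mult)
  finally show ?thesis using N by (simp add: ennreal_le_iff)
qed

lemma block_symmetric_radial:
  fixes f :: "'a \<times> 'b \<Rightarrow> complex"
  assumes "\<And>A. orthogonal_transformation A \<Longrightarrow> (\<And>x. f (A x) = f x)"
  shows "block_symmetric f"
proof -
  have "orthogonal_transformation (map_prod A B)"
    if "orthogonal_transformation A" "orthogonal_transformation B" for A :: "'a \<Rightarrow> 'a" and B :: "'b \<Rightarrow> 'b"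
    using that unfolding orthogonal_transformation_def
    by (auto simp: inner_prod_def linear_iff)
  then have "f (map_prod A B z) = f z"
    if "orthogonal_transformation A" "orthogonal_transformation B" for A :: "'a \<Rightarrow> 'a" and B :: "'b \<Rightarrow> 'b" and z
    using that by (intro assms)
  then show ?thesis
    by (auto simp: block_symmetric_def block_orthogonal_def fun_eq_iff simp flip: map_prod_simp)
qed

lemma block_symmetric_tensor:
  fixes f :: "'a \<Rightarrow> complex" and g :: "'b \<Rightarrow> complex"
  assumes "\<And>A. orthogonal_transformation A \<Longrightarrow> (\<And>x. f (A x) = f x)"
    and "\<And>B. orthogonal_transformation B \<Longrightarrow> (\<And>y. g (B y) = g y)"
  shows "block_symmetric (\<lambda>z. f (fst z) * g (snd z))"
  using assms by (auto simp: block_symmetric_def block_orthogonal_def fun_eq_iff)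

text \<open>The packets tend to \<open>0\<close> uniformly, because they are bounded by the measure of the shell, while their
  transforms stay bounded below on the sphere.\<close>

lemma p_not_infinity: "p \<noteq> \<infinity>"
proof
  assume p: "p = \<infinity>"
  let ?n = "DIM('a \<times> 'b)"
  obtain \<kappa> where \<kappa>: "\<kappa> > 0" "ennreal \<kappa> \<le> emeasure sphere_measure (sphere (0 :: 'a \<times> 'b) 1)"
    using emeasure_sphere_ge unit_ball_vol_pos of_nat_0_le_iff by blast
  have "R powr 1 \<le> enn2real C * shell_const ?n / (packet_const ?n * \<kappa> powr qinv)" if R: "R \<ge> 2" for R
  proof -
    have "packet_const ?n * \<kappa> powr qinv \<le> enn2real C * (shell_const ?n / R)"
    proof (rule restriction_on_subset[where f = "packet R" and A = "sphere 0 1"])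
      show "schwartz (packet R :: 'a \<times> 'b \<Rightarrow> complex)" using R by (intro schwartz_packet) auto
      show "block_symmetric (packet R :: 'a \<times> 'b \<Rightarrow> complex)"
        by (rule block_symmetric_radial) (rule packet_orthogonal)
      show "ennreal \<kappa> \<le> emeasure sphere_measure (sphere (0 :: 'a \<times> 'b) 1)"
        by (rule \<kappa>(2))
      show "packet_const ?n \<le> norm (fourier (packet R) \<xi>)" if "\<xi> \<in> sphere 0 1" for \<xi> :: "'a \<times> 'b"
        using that R by (intro fourier_packet_ge) auto
      show "Lp_norm lborel p (packet R :: 'a \<times> 'b \<Rightarrow> complex) \<le> ennreal (shell_const ?n / R)"
        unfolding p using R by (intro Lp_norm_inf_le norm_packet_le) auto
    qed (use R \<kappa>(1) packet_const_pos[of ?n] shell_const_nonneg[of ?n] in auto)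
    then show ?thesis
      using R packet_const_pos[of ?n] \<kappa>(1) by (subst pos_le_divide_eq) (auto simp: field_simps)
  qed
  then have "(1::real) \<le> 0" by (rule powr_bounded_imp_nonpos)
  then show False by simp
qed

context
  fixes r :: real
  assumes p: "p = ereal r" and r: "1 \<le> r"
begin

lemma radial_bound_whole: "\<exists>K. radial_bound TYPE('a \<times> 'b) r 0 K"
proof -
  obtain \<kappa> where \<kappa>: "\<kappa> > 0" "ennreal \<kappa> \<le> emeasure sphere_measure (sphere (0 :: 'a \<times> 'b) 1)"
    using emeasure_sphere_ge unit_ball_vol_pos of_nat_0_le_iff by blast
  have "radial_bound TYPE('a \<times> 'b) r 0 (enn2real C / \<kappa> powr qinv)"
    unfolding radial_bound_def
  proof (intro allI impI)
    fix \<delta> L I :: real and f :: "'a \<times> 'b \<Rightarrow> complex"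
    assume \<delta>: "0 < \<delta>" "\<delta> \<le> 1" and L: "0 \<le> L" and I: "0 \<le> I" and f: "schwartz f" "integrable lborel f"
      and sym: "\<forall>A. orthogonal_transformation A \<longrightarrow> (\<forall>x. f (A x) = f x)"
      and ge: "\<forall>\<xi>. \<bar>norm \<xi> - 1\<bar> \<le> \<delta>\<^sup>2 \<longrightarrow> L \<le> norm (fourier f \<xi>)"
      and le: "(\<integral>\<^sup>+x. ennreal (norm (f x) powr r) \<partial>lborel) \<le> ennreal I"
    have "L * \<kappa> powr qinv \<le> enn2real C * I powr (1 / r)"
    proof (rule restriction_on_subset[where f = f and A = "sphere 0 1"])
      show "block_symmetric f" using sym by (intro block_symmetric_radial) auto
      show "ennreal \<kappa> \<le> emeasure sphere_measure (sphere (0 :: 'a \<times> 'b) 1)"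
        by (rule \<kappa>(2))
      show "Lp_norm lborel p f \<le> ennreal (I powr (1 / r))"
        unfolding p using r I le by (rule Lp_norm_le)
    qed (use f L ge \<delta> \<kappa>(1) in auto)
    then show "L * \<delta> powr 0 \<le> enn2real C / \<kappa> powr qinv * I powr (1 / r)"
      using \<delta> \<kappa>(1) unfolding times_divide_eq_left by (subst pos_le_divide_eq) auto
  qed
  then show ?thesis ..
qed

lemma fourier_gauss_ge:
  fixes \<eta> :: "'c::euclidean_space"
  assumes \<delta>: "0 < \<delta>" and \<eta>: "norm \<eta> \<le> \<delta>"
  shows "(sqrt (2 * pi) / \<delta>) ^ DIM('c) * exp (- 1 / 2) \<le> norm (fourier (\<lambda>y. complex_of_real (gauss (1 / \<delta>) y)) \<eta>)"
proof -
  have "(norm \<eta>)\<^sup>2 \<le> \<delta>\<^sup>2" using \<eta> by (intro power_mono) auto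
  then have "exp (- 1 / 2) \<le> gauss \<delta> \<eta>" using \<delta> by (simp add: gauss_def field_simps)
  then have "(sqrt (2 * pi) / \<delta>) ^ DIM('c) * exp (- 1 / 2) \<le> (sqrt (2 * pi) / \<delta>) ^ DIM('c) * gauss \<delta> \<eta>"
    using \<delta> by (intro mult_left_mono) auto
  also have "\<dots> = norm (fourier (\<lambda>y. complex_of_real (gauss (1 / \<delta>) y)) \<eta>)"
    using \<delta> by (simp add: fourier_gauss norm_mult norm_power norm_divide)
  finally show ?thesis .
qed

lemma gauss_Lp:
  assumes \<delta>: "0 < \<delta>"
  shows "(\<integral>\<^sup>+y. ennreal (norm (complex_of_real (gauss (1 / \<delta>) y)) powr r) \<partial>(lborel :: 'c::euclidean_space measure))
     \<le> ennreal ((sqrt (2 * pi) / \<delta>) ^ DIM('c))"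
proof -
  have "gauss (1 / \<delta>) y powr r \<le> gauss (1 / \<delta>) y powr 1" for y :: 'c
    using r by (intro powr_mono' gauss_le_1) auto
  then have "(\<integral>\<^sup>+y. ennreal (norm (complex_of_real (gauss (1 / \<delta>) y)) powr r) \<partial>(lborel :: 'c measure))
    \<le> (\<integral>\<^sup>+y. ennreal (gauss (1 / \<delta>) y) \<partial>(lborel :: 'c measure))"
    by (intro nn_integral_mono ennreal_leI) simp
  also have "\<dots> = ennreal ((sqrt (2 * pi) / \<delta>) ^ DIM('c))"
    using \<delta> by (simp add: nn_integral_gauss)
  finally show ?thesis .
qed

text \<open>Collects the powers of \<open>\<delta>\<close>. With \<open>c\<close> the constant of the inequality, \<open>(s/\<delta>)\<^sup>n\<close> is the size
  both of the transform of the Gaussian on the cap and of its integral, and \<open>\<kappa> \<delta>\<^sup>n\<close> is the measure of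
  the cap.\<close>

lemma knapp_rearrange:
  fixes n :: nat
  assumes pos: "0 < \<delta>" "0 < s" "0 < \<kappa>" and I: "0 \<le> I"
    and le: "(L * ((s / \<delta>) ^ n * exp (- 1 / 2))) * (\<kappa> * \<delta> ^ n) powr qinv \<le> c * (I * (s / \<delta>) ^ n) powr (1 / r)"
  shows "L * \<delta> powr (real n * (1 / r + qinv - 1)) \<le> (c * s powr (real n / r) / (s ^ n * exp (- 1 / 2) * \<kappa> powr qinv)) * I powr (1 / r)"
proof -
  let ?D = "\<delta> powr real n"
  have D: "?D > 0" using pos by simp
  have 1: "(\<kappa> * \<delta> ^ n) powr qinv = \<kappa> powr qinv * ?D powr qinv"
    using pos by (simp add: powr_mult powr_realpow)
  have 2: "(I * (s / \<delta>) ^ n) powr (1 / r) = I powr (1 / r) * s powr (real n / r) / ?D powr (1 / r)"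
    using pos I by (simp add: powr_mult powr_divide powr_powr power_divide flip: powr_realpow)
  have 3: "\<delta> powr (real n * (1 / r + qinv - 1)) = ?D powr (1 / r) * ?D powr qinv / ?D"
    using pos by (simp add: powr_powr powr_add[symmetric] powr_diff[symmetric] algebra_simps)
  have "L * (?D powr (1 / r) * ?D powr qinv / ?D) * (s ^ n * exp (- 1 / 2) * \<kappa> powr qinv) =
     ((L * ((s / \<delta>) ^ n * exp (- 1 / 2))) * (\<kappa> * \<delta> ^ n) powr qinv) * ?D powr (1 / r)"
    unfolding 1 using pos by (simp add: power_divide powr_realpow)
  also have "\<dots> \<le> (c * (I * (s / \<delta>) ^ n) powr (1 / r)) * ?D powr (1 / r)"
    using le by (rule mult_right_mono) simp
  also have "\<dots> = c * s powr (real n / r) * I powr (1 / r)"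
    unfolding 2 using D by simp
  finally show ?thesis
    unfolding 3 using pos by (simp add: pos_le_divide_eq)
qed

text \<open>On the cap \<open>|\<eta>| \<le> \<delta>\<close> the Gaussian of width \<open>1/\<delta>\<close> in the second block has a
  transform comparable to its maximum, while \<open>|\<xi>|\<^sup>2 = 1 - |\<eta>|\<^sup>2\<close> puts \<open>|\<xi>|\<close> within \<open>\<delta>\<^sup>2\<close>
  of \<open>1\<close>.\<close>

lemma radial_bound_fst: "\<exists>K. radial_bound TYPE('a) r (real DIM('b) * (1 / r + qinv - 1)) K"
proof (intro exI)
  let ?s = "sqrt (2 * pi)" and ?\<kappa> = "cap_const DIM('a) DIM('b)" and ?n = "DIM('b)"
  show "radial_bound TYPE('a) r (real ?n * (1 / r + qinv - 1)) (enn2real C * ?s powr (real ?n / r) / (?s ^ ?n * exp (- 1 / 2) * ?\<kappa> powr qinv))"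
    unfolding radial_bound_def
  proof (intro allI impI)
    fix \<delta> L I :: real and f :: "'a \<Rightarrow> complex"
    assume \<delta>: "0 < \<delta>" "\<delta> \<le> 1" and L: "0 \<le> L" and I: "0 \<le> I" and f: "schwartz f" "integrable lborel f"
      and sym: "\<forall>A. orthogonal_transformation A \<longrightarrow> (\<forall>x. f (A x) = f x)"
      and ge: "\<forall>\<xi>. \<bar>norm \<xi> - 1\<bar> \<le> \<delta>\<^sup>2 \<longrightarrow> L \<le> norm (fourier f \<xi>)"
      and le: "(\<integral>\<^sup>+x. ennreal (norm (f x) powr r) \<partial>lborel) \<le> ennreal I"
    let ?g = "\<lambda>y::'b. complex_of_real (gauss (1 / \<delta>) y)"
    let ?A = "{z :: 'a \<times> 'b. norm z = 1 \<and> norm (snd z) \<le> \<delta>}"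
    have g: "integrable lborel ?g"
      using has_bochner_integral_gauss[of "1 / \<delta>", where 'a='b] \<delta> by (simp add: has_bochner_integral_iff)
    have [measurable]: "f \<in> borel_measurable borel" using f(2) by (auto dest: borel_measurable_integrable)
    have "(L * ((?s / \<delta>) ^ ?n * exp (- 1 / 2))) * (?\<kappa> * \<delta> ^ ?n) powr qinv \<le> enn2real C * (I * (?s / \<delta>) ^ ?n) powr (1 / r)"
    proof (rule restriction_on_subset[where f = "\<lambda>z. f (fst z) * ?g (snd z)" and A = ?A])
      show "schwartz (\<lambda>z. f (fst z) * ?g (snd z))"
        using f \<delta> by (intro schwartz_tensor schwartz_gauss) auto
      show "block_symmetric (\<lambda>z. f (fst z) * ?g (snd z))"
        using sym by (intro block_symmetric_tensor) (auto simp: gauss_def orthogonal_transformation_norm)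
      show "?A \<in> sets borel"
        by (auto intro!: borel_closed closed_Collect_conj closed_Collect_eq closed_Collect_le continuous_intros)
      show "ennreal (?\<kappa> * \<delta> ^ ?n) \<le> emeasure sphere_measure ?A" using \<delta> by (rule emeasure_snd_cap_ge)
      show "L * ((?s / \<delta>) ^ ?n * exp (- 1 / 2)) \<le> norm (fourier (\<lambda>z. f (fst z) * ?g (snd z)) \<zeta>)" if "\<zeta> \<in> ?A" for \<zeta>
        unfolding fourier_tensor[OF f(2) g] norm_mult
      proof (intro mult_mono fourier_gauss_ge ge[rule_format])
        have "(norm (fst \<zeta>))\<^sup>2 + (norm (snd \<zeta>))\<^sup>2 = 1" using that norm_Pair[of "fst \<zeta>" "snd \<zeta>"] by simp
        moreover have "(norm (snd \<zeta>))\<^sup>2 \<le> \<delta>\<^sup>2" using that by (intro power_mono) auto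
        ultimately show "\<bar>norm (fst \<zeta>) - 1\<bar> \<le> \<delta>\<^sup>2" by (intro near_one_of_square[of _ "(norm (snd \<zeta>))\<^sup>2"]) auto
      qed (use that \<delta> L in auto)
      show "Lp_norm lborel p (\<lambda>z. f (fst z) * ?g (snd z)) \<le> ennreal ((I * (?s / \<delta>) ^ ?n) powr (1 / r))"
        unfolding p
      proof (rule Lp_norm_le[OF r])
        show "(\<integral>\<^sup>+z. ennreal (norm (f (fst z) * ?g (snd z)) powr r) \<partial>lborel) \<le> ennreal (I * (?s / \<delta>) ^ ?n)"
          using I \<delta> le gauss_Lp[OF \<delta>(1), where 'c='b]
          by (subst nn_integral_tensor) (auto simp: ennreal_mult intro!: mult_mono)
      qed (use I \<delta> in auto)
    qed (use L I \<delta> cap_const_pos in auto)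
    then show "L * \<delta> powr (real ?n * (1 / r + qinv - 1)) \<le> enn2real C * ?s powr (real ?n / r) / (?s ^ ?n * exp (- 1 / 2) * ?\<kappa> powr qinv) * I powr (1 / r)"
      using \<delta> I cap_const_pos by (intro knapp_rearrange) auto
  qed
qed

lemma radial_bound_snd: "\<exists>K. radial_bound TYPE('b) r (real DIM('a) * (1 / r + qinv - 1)) K"
proof (intro exI)
  let ?s = "sqrt (2 * pi)" and ?\<kappa> = "cap_const DIM('a) DIM('b)" and ?n = "DIM('a)"
  show "radial_bound TYPE('b) r (real ?n * (1 / r + qinv - 1)) (enn2real C * ?s powr (real ?n / r) / (?s ^ ?n * exp (- 1 / 2) * ?\<kappa> powr qinv))"
    unfolding radial_bound_def
  proof (intro allI impI)
    fix \<delta> L I :: real and f :: "'b \<Rightarrow> complex"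
    assume \<delta>: "0 < \<delta>" "\<delta> \<le> 1" and L: "0 \<le> L" and I: "0 \<le> I" and f: "schwartz f" "integrable lborel f"
      and sym: "\<forall>A. orthogonal_transformation A \<longrightarrow> (\<forall>x. f (A x) = f x)"
      and ge: "\<forall>\<xi>. \<bar>norm \<xi> - 1\<bar> \<le> \<delta>\<^sup>2 \<longrightarrow> L \<le> norm (fourier f \<xi>)"
      and le: "(\<integral>\<^sup>+x. ennreal (norm (f x) powr r) \<partial>lborel) \<le> ennreal I"
    let ?g = "\<lambda>y::'a. complex_of_real (gauss (1 / \<delta>) y)"
    let ?A = "{z :: 'a \<times> 'b. norm z = 1 \<and> norm (fst z) \<le> \<delta>}"
    have g: "integrable lborel ?g"
      using has_bochner_integral_gauss[of "1 / \<delta>", where 'a='a] \<delta> by (simp add: has_bochner_integral_iff)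
    have [measurable]: "f \<in> borel_measurable borel" using f(2) by (auto dest: borel_measurable_integrable)
    have "(L * ((?s / \<delta>) ^ ?n * exp (- 1 / 2))) * (?\<kappa> * \<delta> ^ ?n) powr qinv \<le> enn2real C * (I * (?s / \<delta>) ^ ?n) powr (1 / r)"
    proof (rule restriction_on_subset[where f = "\<lambda>z. ?g (fst z) * f (snd z)" and A = ?A])
      show "schwartz (\<lambda>z. ?g (fst z) * f (snd z))"
        using f \<delta> by (intro schwartz_tensor schwartz_gauss) auto
      show "block_symmetric (\<lambda>z. ?g (fst z) * f (snd z))"
        using sym by (intro block_symmetric_tensor) (auto simp: gauss_def orthogonal_transformation_norm)
      show "?A \<in> sets borel"
        by (auto intro!: borel_closed closed_Collect_conj closed_Collect_eq closed_Collect_le continuous_intros)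
      show "ennreal (?\<kappa> * \<delta> ^ ?n) \<le> emeasure sphere_measure ?A" using \<delta> by (rule emeasure_fst_cap_ge)
      show "L * ((?s / \<delta>) ^ ?n * exp (- 1 / 2)) \<le> norm (fourier (\<lambda>z. ?g (fst z) * f (snd z)) \<zeta>)" if "\<zeta> \<in> ?A" for \<zeta>
        unfolding fourier_tensor[OF g f(2)] norm_mult mult.commute[of "norm (fourier ?g _)"]
      proof (intro mult_mono fourier_gauss_ge ge[rule_format])
        have "(norm (fst \<zeta>))\<^sup>2 + (norm (snd \<zeta>))\<^sup>2 = 1" using that norm_Pair[of "fst \<zeta>" "snd \<zeta>"] by simp
        moreover have "(norm (fst \<zeta>))\<^sup>2 \<le> \<delta>\<^sup>2" using that by (intro power_mono) auto
        ultimately show "\<bar>norm (snd \<zeta>) - 1\<bar> \<le> \<delta>\<^sup>2" by (intro near_one_of_square[of _ "(norm (fst \<zeta>))\<^sup>2"]) auto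
      qed (use that \<delta> L in auto)
      show "Lp_norm lborel p (\<lambda>z. ?g (fst z) * f (snd z)) \<le> ennreal ((I * (?s / \<delta>) ^ ?n) powr (1 / r))"
        unfolding p
      proof (rule Lp_norm_le[OF r])
        show "(\<integral>\<^sup>+z. ennreal (norm (?g (fst z) * f (snd z)) powr r) \<partial>lborel) \<le> ennreal (I * (?s / \<delta>) ^ ?n)"
          using I \<delta> le gauss_Lp[OF \<delta>(1), where 'c='a]
          by (subst nn_integral_tensor) (auto simp: ennreal_mult mult.commute[of "ennreal I"] intro!: mult_mono)
      qed (use I \<delta> in auto)
    qed (use L I \<delta> cap_const_pos in auto)
    then show "L * \<delta> powr (real ?n * (1 / r + qinv - 1)) \<le> enn2real C * ?s powr (real ?n / r) / (?s ^ ?n * exp (- 1 / 2) * ?\<kappa> powr qinv) * I powr (1 / r)"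
      using \<delta> I cap_const_pos by (intro knapp_rearrange) auto
  qed
qed

end

end

theorem theorem1p3:
  fixes d k m :: nat and p q :: ereal and C :: ennreal
  assumes "d \<ge> 4" and "k \<in> {2..d - 2}" and "m = min (d - k) k"
    and "CARD('a::finite) = d - k" and "CARD('b::finite) = k"
    and "1 \<le> p" and "1 \<le> q"
    and "C < \<infinity>"
    and "\<forall>f :: (real ^ 'a) \<times> (real ^ 'b) \<Rightarrow> complex. schwartz f \<longrightarrow> block_symmetric f \<longrightarrow>
           Lp_norm sphere_measure q (fourier f) \<le> C * Lp_norm lborel p f"
  shows "ereal ((real d + 1) / (2 * real d)) < 1 / p \<and>
         1 / p < ereal ((real m + 1) / (2 * real m)) \<and>
         ereal (real d + real m) / p + ereal (real d - real m) / q \<ge> ereal (real d + 1)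
       \<or> 1 / p = ereal ((real m + 1) / (2 * real m)) \<and> 1 / p + 1 / q > 1
       \<or> 1 / p > ereal ((real m + 1) / (2 * real m)) \<and> 1 / p + 1 / q \<ge> 1"
proof -
  interpret block_restriction "TYPE((real ^ 'a) \<times> (real ^ 'b))" p q C
    using assms by unfold_locales auto
  have dims: "DIM(real ^ 'a) = d - k" "DIM(real ^ 'b) = k" "DIM((real ^ 'a) \<times> (real ^ 'b)) = d"
    using assms by auto
  have m: "2 \<le> m" "m < d" using assms(1-3) by auto
  obtain r where p: "p = ereal r" and r: "1 \<le> r"
    using \<open>1 \<le> p\<close> p_not_infinity by (cases p) (auto simp: one_ereal_def)
  define a where "a = 1 / r"
  have a: "1 / p = ereal a" "ereal x / p = ereal (x * a)" for x
    using r by (auto simp: p a_def one_ereal_def)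
  have qinv: "1 / q = ereal qinv" "ereal x / q = ereal (x * qinv)" for x
  proof -
    have "1 / q = ereal (real_of_ereal (1 / q)) \<and> ereal x / q = ereal (x * real_of_ereal (1 / q))"
    proof (cases q)
      case (real s)
      then have "s \<noteq> 0" using \<open>1 \<le> q\<close> by auto
      then show ?thesis using real by (simp add: one_ereal_def)
    qed (use \<open>1 \<le> q\<close> in auto)
    then show "1 / q = ereal qinv" "ereal x / q = ereal (x * qinv)" unfolding qinv_def by auto
  qed
  obtain K where whole: "radial_bound TYPE((real ^ 'a) \<times> (real ^ 'b)) r 0 K"
    using radial_bound_whole[OF p r] by blast
  \<comment> \<open>A bound on the whole space has \<open>t = 0\<close>, so it forces \<open>p < 2\<close> and then \<open>1/p > (d+1)/(2d)\<close>.\<close>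
  have r2: "r \<le> 2" using radial_bound_less_2[OF whole] by simp
  have lower: "(real d + 1) / (2 * real d) < a"
  proof -
    have "2 \<le> d" using assms(1) by simp
    note * = radial_bound_exponents[OF whole r r2, unfolded dims, OF this, folded a_def]
    have "(real d + 1) / (2 * real d) \<le> a"
      using *(2) assms(1) by (subst pos_divide_le_eq) (auto simp: mult.commute)
    then show ?thesis using *(3) by simp
  qed
  \<comment> \<open>The packets live in the block of dimension \<open>m\<close>, the Gaussian in the other one.\<close>
  let ?t = "(real d - real m) * (a + qinv - 1)"
  have key: "0 \<le> ?t \<and> real m + 1 \<le> ?t + 2 * real m * a \<and> (?t = 0 \<longrightarrow> a \<noteq> (real m + 1) / (2 * real m))"
  proof -
    show ?thesis
    proof (cases "k \<le> d - k")
      case True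
      then have mk: "DIM(real ^ 'b) = m" using assms dims by simp
      then have "real DIM(real ^ 'a) = real d - real m" using dims assms by (simp add: of_nat_diff)
      then obtain K where "radial_bound TYPE(real ^ 'b) r ?t K"
        using radial_bound_snd[OF p r] unfolding a_def by auto
      from radial_bound_exponents[OF this r r2, unfolded mk, OF m(1)] show ?thesis
        unfolding a_def by blast
    next
      case False
      then have mk: "DIM(real ^ 'a) = m" using assms dims by simp
      then have "real DIM(real ^ 'b) = real d - real m" using dims assms False by (simp add: of_nat_diff)
      then obtain K where "radial_bound TYPE(real ^ 'a) r ?t K"
        using radial_bound_fst[OF p r] unfolding a_def by auto
      from radial_bound_exponents[OF this r r2, unfolded mk, OF m(1)] show ?thesis
        unfolding a_def by blast
    qed
  qed
  have dm: "real d - real m > 0" using m by simp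
  then have ab: "1 \<le> a + qinv" using key by (simp add: zero_le_mult_iff)
  have mixed: "real d + 1 \<le> (real d + real m) * a + (real d - real m) * qinv"
    using key by (simp add: algebra_simps)
  have strict: "1 < a + qinv" if "a = (real m + 1) / (2 * real m)"
    using key that ab dm by auto
  have one: "1 = ereal 1" by (simp add: one_ereal_def)
  consider "a < (real m + 1) / (2 * real m)" | "a = (real m + 1) / (2 * real m)" | "a > (real m + 1) / (2 * real m)"
    by linarith
  then show ?thesis
    unfolding a qinv plus_ereal.simps one ereal_less_eq ereal_less ereal.inject
    using lower ab mixed strict by cases auto
qed

end
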